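(* Let $(g(n))_{n\in\mathbb N}$ be any sequence of positive numbers with $\lim_{n\to+\infty}g(n)=+\infty$, and consider the scale $a(n,t)=n(g(n))^t$. Let $\beta\in(0,1]$ and let $(T_t)_{t\in\mathbb R}$ be a $\beta$-rank one flow. Then its $\beta$-slow entropy with respect to this scale satisfies $h_s^\beta(T_t)=0$.
   Context: **Slow entropy.** Let $(T_t)_{t\in\mathbb R}$ be a measure-preserving flow on a probability Borel space $(X,\mathcal B,\mu)$ and $\mathcal P=\{P_1,\dots,P_k\}$ a finite measurable partition of $X$. For $r>0$ let $\Omega_{k,r}$ be the set of (measurable) $w=(w_t)_{t\in[0,r]}$ with $w_t\in\{1,\dots,k\}$, with the Hamming distance $d_r(w,w')=\frac1r\left(r-\lambda\{s\in[0,r]: w_s=w'_s\}\right)$, $\lambda$ being Lebesgue measure. The $\mathcal P,r$-name of $x\in X$ is $\phi_{\mathcal P,r}(x)=(N_t(x))_{t\in[0,r]}$ where $N_t(x)=i$ iff $T_tx\in P_i$. Put $\nu=(\phi_{\mathcal P,r})_*\mu$. For $\epsilon>0$, $\beta\in(0,1]$, let $S^r_{\mathcal P}(\epsilon,\beta)$ be the minimal number of $d_r$-balls of radius $\epsilon$ whose union has $\nu$-measure greater than $\beta-\epsilon$. Given a scale $a(n,t)$ ($n\in\mathbb N$, $t>0$), with $a(n,t)\to\infty$ as $n\to\infty$ for each fixed $t$, let $$A(\mathcal P,\epsilon,\beta)=\sup\Big\{t>0:\ \liminf_{r\to+\infty}\frac{S^r_{\mathcal P}(\epsilon,\beta)}{a([r],t)}>0\Big\}$$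 (supremum of the empty set being $0$), $A^\beta(\mathcal P)=\lim_{\epsilon\to0}A(\mathcal P,\epsilon,\beta)$, and $h^\beta_s(T_t)=\sup_{\mathcal P}A^\beta(\mathcal P)$, the supremum over all finite measurable partitions. **Towers and $\beta$-rank one.** Let $(T_t)$ be an ergodic flow on $(X,\mathcal B,\mu)$. For every $H>0$ and $\eta\in(0,1)$ the flow can be represented as (is isomorphic to, and is identified with) a special flow over an ergodic automorphism $S$ of a probability space $(Y,\mathcal C,\nu)$ under a roof function $\phi$ such that $\phi(y)\le H$ for every $y\in Y$ and such that there is a set $B=B(\eta,H)\in\mathcal C$ with $\nu(B)>1-\eta$ and $\phi(y)=H$ for every $y\in B$; the base $Y$ is viewed as the subset $Y\times\{0\}$ of $X$. The set $\bigcup_{0\le s<H}T_s(B)$ is called a tower for $(T_t)$ and the sets $T_s(B)$, $0\le s<H$, are its levels. For a finite partition $\mathcal P$ of $X$ and $\epsilon>0$, a level $T_s(B)$ is $\epsilon$-monochromatic (for $\mathcal P$) if its $1-\epsilon$ proportion with respect to the measure $(T_s)_*\nu$ is contained in one atom of $\mathcal P$; a tower is $\epsilon$-monochromatic (for $\mathcal P$) if a $1-\epsilon$ proportion of its levels (with respect to Lebesgue measure on $[0,H]$) is $\epsilon$-monochromatic. For $\beta\in(0,1]$, an ergodic flow $(T_t)$ is a $\beta$-rank one flow if for every $\epsilon>0$ and every finite partition $\mathcal P$ of $X$ there exists a tower for $(T_t)$ of $\mu$-measure greater than $\beta-\epsilon$ which is $\epsilon$-monochromatic for $\mathcal P$.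 *)

theory Defs
  imports "HOL-Analysis.Analysis" "HOL-Probability.Probability"
begin

section \<open>Flows\<close>

definition standard_borel :: "'a measure \<Rightarrow> bool" where
  "standard_borel M \<longleftrightarrow>
     (\<exists>X. completely_metrizable_space X \<and> second_countable X \<and> topspace X = space M \<and>
          sets M = sigma_sets (topspace X) {U. openin X U})"

locale measure_preserving_flow = prob_space M
  for M :: "'a measure" and T :: "real \<Rightarrow> 'a \<Rightarrow> 'a" +
  assumes standard_borel: "standard_borel M"
    and flow_measurable: "(\<lambda>(t, x). T t x) \<in> (borel \<Otimes>\<^sub>M M) \<rightarrow>\<^sub>M M"
    and flow_zero: "x \<in> space M \<Longrightarrow> T 0 x = x"
    and flow_add: "x \<in> space M \<Longrightarrow> T (s + t) x = T s (T t x)"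
    and flow_preserving: "distr M M (T t) = M"

locale ergodic_flow = measure_preserving_flow +
  assumes ergodic:
    "\<lbrakk>A \<in> sets M; \<And>t. T t -` A \<inter> space M = A\<rbrakk> \<Longrightarrow> measure M A = 0 \<or> measure M A = 1"

text \<open>
  A finite measurable partition is given with a labelling \<open>P 1, \<dots>, P k\<close> of its (nonempty) atoms.
\<close>
definition finite_measurable_partition :: "'a measure \<Rightarrow> nat \<Rightarrow> (nat \<Rightarrow> 'a set) \<Rightarrow> bool" where
  "finite_measurable_partition M k P \<longleftrightarrow>
     P ` {1..k} \<subseteq> sets M \<and> inj_on P {1..k} \<and> partition_on (space M) (P ` {1..k})"


section \<open>Slow entropy\<close>

definition words :: "nat \<Rightarrow> real \<Rightarrow> (real \<Rightarrow> nat) set" where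
  "words k r = {w \<in> extensional {0..r}. w \<in> restrict_space borel {0..r} \<rightarrow>\<^sub>M count_space {1..k}}"

definition hamming_dist :: "real \<Rightarrow> (real \<Rightarrow> nat) \<Rightarrow> (real \<Rightarrow> nat) \<Rightarrow> real" where
  "hamming_dist r w w' = (1 / r) * (r - measure lborel {s \<in> {0..r}. w s = w' s})"

definition hamming_ball :: "nat \<Rightarrow> real \<Rightarrow> (real \<Rightarrow> nat) \<Rightarrow> real \<Rightarrow> (real \<Rightarrow> nat) set" where
  "hamming_ball k r w \<epsilon> = {w' \<in> words k r. hamming_dist r w w' < \<epsilon>}"

definition orbit_name ::
    "(real \<Rightarrow> 'a \<Rightarrow> 'a) \<Rightarrow> nat \<Rightarrow> (nat \<Rightarrow> 'a set) \<Rightarrow> real \<Rightarrow> 'a \<Rightarrow> real \<Rightarrow> nat" where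
  "orbit_name T k P r x = (\<lambda>t\<in>{0..r}. THE i. i \<in> {1..k} \<and> T t x \<in> P i)"

text \<open>The space of words carries the \<open>\<sigma>\<close>-algebra generated by the Hamming balls.\<close>
definition name_measure ::
    "'a measure \<Rightarrow> (real \<Rightarrow> 'a \<Rightarrow> 'a) \<Rightarrow> nat \<Rightarrow> (nat \<Rightarrow> 'a set) \<Rightarrow> real \<Rightarrow> (real \<Rightarrow> nat) measure" where
  "name_measure M T k P r =
     distr M (sigma (words k r) {hamming_ball k r w \<epsilon> | w \<epsilon>. w \<in> words k r \<and> 0 < \<epsilon>})
       (orbit_name T k P r)"

definition covering_number ::
    "'a measure \<Rightarrow> (real \<Rightarrow> 'a \<Rightarrow> 'a) \<Rightarrow> nat \<Rightarrow> (nat \<Rightarrow> 'a set) \<Rightarrow> real \<Rightarrow> real \<Rightarrow> real \<Rightarrow> enat" where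
  "covering_number M T k P r \<epsilon> \<beta> =
     (INF C \<in> {C. finite C \<and> C \<subseteq> words k r \<and>
                  measure (name_measure M T k P r) (\<Union>w\<in>C. hamming_ball k r w \<epsilon>) > \<beta> - \<epsilon>}.
        enat (card C))"

text \<open>In \<open>ennreal\<close> the supremum of the empty set is \<open>0\<close>.\<close>
definition growth_rate ::
    "'a measure \<Rightarrow> (real \<Rightarrow> 'a \<Rightarrow> 'a) \<Rightarrow> (nat \<Rightarrow> real \<Rightarrow> real) \<Rightarrow>
     nat \<Rightarrow> (nat \<Rightarrow> 'a set) \<Rightarrow> real \<Rightarrow> real \<Rightarrow> ennreal" where
  "growth_rate M T a k P \<epsilon> \<beta> =
     (SUP t \<in> {t. 0 < t \<and>
                  Liminf at_top (\<lambda>r::real. ennreal_of_enat (covering_number M T k P r \<epsilon> \<beta>)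
                                            / ennreal (a (nat \<lfloor>r\<rfloor>) t)) > 0}.
        ennreal t)"

definition partition_slow_entropy ::
    "'a measure \<Rightarrow> (real \<Rightarrow> 'a \<Rightarrow> 'a) \<Rightarrow> (nat \<Rightarrow> real \<Rightarrow> real) \<Rightarrow> real \<Rightarrow>
     nat \<Rightarrow> (nat \<Rightarrow> 'a set) \<Rightarrow> ennreal" where
  "partition_slow_entropy M T a \<beta> k P = Lim (at_right 0) (\<lambda>\<epsilon>. growth_rate M T a k P \<epsilon> \<beta>)"

definition slow_entropy ::
    "'a measure \<Rightarrow> (real \<Rightarrow> 'a \<Rightarrow> 'a) \<Rightarrow> (nat \<Rightarrow> real \<Rightarrow> real) \<Rightarrow> real \<Rightarrow> ennreal" where
  "slow_entropy M T a \<beta> =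
     (SUP (k, P) \<in> {(k, P). finite_measurable_partition M k P}. partition_slow_entropy M T a \<beta> k P)"


section \<open>Special flows\<close>

locale ergodic_automorphism = prob_space N
  for N :: "'b measure" and S :: "'b \<Rightarrow> 'b" +
  assumes auto_bij: "bij_betw S (space N) (space N)"
    and auto_measurable: "S \<in> N \<rightarrow>\<^sub>M N"
    and auto_inv_measurable: "inv_into (space N) S \<in> N \<rightarrow>\<^sub>M N"
    and auto_preserving: "distr N N S = N"
    and auto_ergodic:
      "\<lbrakk>A \<in> sets N; S -` A \<inter> space N = A\<rbrakk> \<Longrightarrow> measure N A = 0 \<or> measure N A = 1"

definition iterate :: "'b measure \<Rightarrow> ('b \<Rightarrow> 'b) \<Rightarrow> int \<Rightarrow> 'b \<Rightarrow> 'b" where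
  "iterate N S n =
     (if 0 \<le> n then S ^^ nat n else inv_into (space N) S ^^ nat (- n))"

definition roof_sum :: "'b measure \<Rightarrow> ('b \<Rightarrow> 'b) \<Rightarrow> ('b \<Rightarrow> real) \<Rightarrow> int \<Rightarrow> 'b \<Rightarrow> real" where
  "roof_sum N S \<phi> n y =
     (if 0 \<le> n then \<Sum>j\<in>{0..<n}. \<phi> (iterate N S j y) else - (\<Sum>j\<in>{n..<0}. \<phi> (iterate N S j y)))"

text \<open>
  The divergence conditions make the special flow defined for all times and at all points.  By
  Poincar\'e recurrence they hold outside an \<open>S\<close>-invariant null set, which can be removed from the
  base.
\<close>
definition roof_function :: "'b measure \<Rightarrow> ('b \<Rightarrow> 'b) \<Rightarrow> ('b \<Rightarrow> real) \<Rightarrow> bool" where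
  "roof_function N S \<phi> \<longleftrightarrow>
     \<phi> \<in> borel_measurable N \<and> integrable N \<phi> \<and>
     (\<forall>y\<in>space N. 0 < \<phi> y \<and>
        filterlim (\<lambda>n. roof_sum N S \<phi> n y) at_top at_top \<and>
        filterlim (\<lambda>n. roof_sum N S \<phi> n y) at_bot at_bot)"

definition special_space :: "'b measure \<Rightarrow> ('b \<Rightarrow> real) \<Rightarrow> ('b \<times> real) set" where
  "special_space N \<phi> = {(y, s). y \<in> space N \<and> 0 \<le> s \<and> s < \<phi> y}"

definition special_measure :: "'b measure \<Rightarrow> ('b \<Rightarrow> real) \<Rightarrow> ('b \<times> real) measure" where
  "special_measure N \<phi> =
     scale_measure (1 / (\<integral>\<^sup>+ y. ennreal (\<phi> y) \<partial>N))
       (restrict_space (N \<Otimes>\<^sub>M lborel) (special_space N \<phi>))"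

definition special_flow ::
    "'b measure \<Rightarrow> ('b \<Rightarrow> 'b) \<Rightarrow> ('b \<Rightarrow> real) \<Rightarrow> real \<Rightarrow> 'b \<times> real \<Rightarrow> 'b \<times> real" where
  "special_flow N S \<phi> t = (\<lambda>(y, s).
     let n = (THE n. roof_sum N S \<phi> n y \<le> s + t \<and> s + t < roof_sum N S \<phi> (n + 1) y)
     in (iterate N S n y, s + t - roof_sum N S \<phi> n y))"

text \<open>
  \<open>\<psi>\<close>, restricted to \<open>Z\<^sub>0\<close>, is an isomorphism of the flow \<open>(Z, U)\<close> onto the flow \<open>(M, T)\<close> modulo
  null sets.
\<close>
definition flow_isomorphism ::
    "'c measure \<Rightarrow> (real \<Rightarrow> 'c \<Rightarrow> 'c) \<Rightarrow> 'a measure \<Rightarrow> (real \<Rightarrow> 'a \<Rightarrow> 'a) \<Rightarrow>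
     'c set \<Rightarrow> ('c \<Rightarrow> 'a) \<Rightarrow> bool" where
  "flow_isomorphism Z U M T Z\<^sub>0 \<psi> \<longleftrightarrow>
     Z\<^sub>0 \<in> sets Z \<and> emeasure Z (space Z - Z\<^sub>0) = 0 \<and> (\<forall>t. U t ` Z\<^sub>0 = Z\<^sub>0) \<and>
     \<psi> ` Z\<^sub>0 \<in> sets M \<and> emeasure M (space M - \<psi> ` Z\<^sub>0) = 0 \<and>
     inj_on \<psi> Z\<^sub>0 \<and>
     \<psi> \<in> restrict_space Z Z\<^sub>0 \<rightarrow>\<^sub>M restrict_space M (\<psi> ` Z\<^sub>0) \<and>
     inv_into Z\<^sub>0 \<psi> \<in> restrict_space M (\<psi> ` Z\<^sub>0) \<rightarrow>\<^sub>M restrict_space Z Z\<^sub>0 \<and>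
     distr (restrict_space Z Z\<^sub>0) (restrict_space M (\<psi> ` Z\<^sub>0)) \<psi> = restrict_space M (\<psi> ` Z\<^sub>0) \<and>
     (\<forall>t. \<forall>z\<in>Z\<^sub>0. \<psi> (U t z) = T t (\<psi> z))"


section \<open>Towers and rank one\<close>

text \<open>
  A representation of \<open>(M, T)\<close> as a special flow over \<open>(N, S)\<close> under \<open>\<phi> \<le> H\<close>, together with a set
  \<open>B\<close> in the base above which the roof has height exactly \<open>H\<close>.
\<close>
definition special_representation ::
    "'a measure \<Rightarrow> (real \<Rightarrow> 'a \<Rightarrow> 'a) \<Rightarrow> real \<Rightarrow> real \<Rightarrow> 'b measure \<Rightarrow> ('b \<Rightarrow> 'b) \<Rightarrow> ('b \<Rightarrow> real) \<Rightarrow>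
     'b set \<Rightarrow> ('b \<times> real) set \<Rightarrow> ('b \<times> real \<Rightarrow> 'a) \<Rightarrow> bool" where
  "special_representation M T H \<eta> N S \<phi> B Z\<^sub>0 \<psi> \<longleftrightarrow>
     ergodic_automorphism N S \<and> roof_function N S \<phi> \<and>
     flow_isomorphism (special_measure N \<phi>) (special_flow N S \<phi>) M T Z\<^sub>0 \<psi> \<and>
     (\<forall>y\<in>space N. \<phi> y \<le> H) \<and>
     B \<in> sets N \<and> measure N B > 1 - \<eta> \<and> (\<forall>y\<in>B. \<phi> y = H)"

text \<open>
  \<open>base_copy\<close> and \<open>base_measure\<close> realise \<open>B\<close> and the measure of the base inside the phase space of
  the flow, through \<open>y \<mapsto> (y, 0) \<mapsto> \<psi> (y, 0)\<close>.
\<close>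
definition base_copy :: "'b set \<Rightarrow> ('b \<times> real) set \<Rightarrow> ('b \<times> real \<Rightarrow> 'a) \<Rightarrow> 'a set" where
  "base_copy B Z\<^sub>0 \<psi> = \<psi> ` ((B \<times> {0}) \<inter> Z\<^sub>0)"

definition base_measure ::
    "'a measure \<Rightarrow> 'b measure \<Rightarrow> ('b \<times> real) set \<Rightarrow> ('b \<times> real \<Rightarrow> 'a) \<Rightarrow> 'a measure" where
  "base_measure M N Z\<^sub>0 \<psi> =
     distr (restrict_space N {y. (y, 0) \<in> Z\<^sub>0}) M (\<lambda>y. \<psi> (y, 0))"

definition tower :: "(real \<Rightarrow> 'a \<Rightarrow> 'a) \<Rightarrow> real \<Rightarrow> 'a set \<Rightarrow> 'a set" where
  "tower T H B = (\<Union>s\<in>{0..<H}. T s ` B)"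

definition monochromatic_level ::
    "'a measure \<Rightarrow> (real \<Rightarrow> 'a \<Rightarrow> 'a) \<Rightarrow> 'a measure \<Rightarrow> 'a set \<Rightarrow> nat \<Rightarrow> (nat \<Rightarrow> 'a set) \<Rightarrow>
     real \<Rightarrow> real \<Rightarrow> bool" where
  "monochromatic_level M T \<nu> B k P \<epsilon> s \<longleftrightarrow>
     (\<exists>i\<in>{1..k}. measure (distr \<nu> M (T s)) (T s ` B \<inter> P i)
                  \<ge> (1 - \<epsilon>) * measure (distr \<nu> M (T s)) (T s ` B))"

definition monochromatic_tower ::
    "'a measure \<Rightarrow> (real \<Rightarrow> 'a \<Rightarrow> 'a) \<Rightarrow> 'a measure \<Rightarrow> real \<Rightarrow> 'a set \<Rightarrow> nat \<Rightarrow> (nat \<Rightarrow> 'a set) \<Rightarrow>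
     real \<Rightarrow> bool" where
  "monochromatic_tower M T \<nu> H B k P \<epsilon> \<longleftrightarrow>
     measure lborel {s \<in> {0..<H}. monochromatic_level M T \<nu> B k P \<epsilon> s} \<ge> (1 - \<epsilon>) * H"

text \<open>
  The base of the representing special flow is taken on the type of the phase space.  This is no
  restriction, since \<open>y \<mapsto> \<psi> (y, 0)\<close> embeds the base, up to an invariant null set, into it.
\<close>
definition beta_rank_one_flow :: "'a measure \<Rightarrow> (real \<Rightarrow> 'a \<Rightarrow> 'a) \<Rightarrow> real \<Rightarrow> bool" where
  "beta_rank_one_flow M T \<beta> \<longleftrightarrow>
     ergodic_flow M T \<and>
     (\<forall>\<epsilon>>0. \<forall>k P. finite_measurable_partition M k P \<longrightarrow>
        (\<exists>H>0. \<exists>\<eta>\<in>{0<..<1}. \<exists>(N :: 'a measure) S \<phi> B Z\<^sub>0 \<psi>.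
           special_representation M T H \<eta> N S \<phi> B Z\<^sub>0 \<psi> \<and>
           measure M (tower T H (base_copy B Z\<^sub>0 \<psi>)) > \<beta> - \<epsilon> \<and>
           monochromatic_tower M T (base_measure M N Z\<^sub>0 \<psi>) H (base_copy B Z\<^sub>0 \<psi>) k P \<epsilon>))"

end

theory Submission
  imports Defs
begin

text \<open>
  Call the index of the atom of \<open>P\<close> containing a point its colour.  If the levels of a tower of height
  \<open>H\<close> are nearly monochromatic, a point that starts in the level at height \<open>s\<close> and stays in the tower
  up to time \<open>r\<close> sees, up to a small Hamming error, the colours of the levels at heights between \<open>s\<close>
  and \<open>s + r\<close>.  So its name is determined by \<open>s\<close>, and since \<open>T\<^sub>v\<close> tends to the identity in measure as
  \<open>v\<close> tends to \<open>0\<close> (\<open>colour_continuity\<close>), moving \<open>s\<close> by less than some \<open>h\<^sub>0\<close> changes the name little;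
  here \<open>h\<^sub>0\<close> depends on the flow, \<open>P\<close> and \<open>\<epsilon>\<close> only.  Hence about \<open>H / h\<^sub>0\<close> balls cover most of the
  tower.  With \<open>r = \<kappa> H\<close> for a small constant \<open>\<kappa>\<close>, only a proportion \<open>\<kappa>\<close> of the tower is lost by
  demanding that the orbit stays inside, and the number of balls is at most a constant times \<open>r\<close>.  If
  this happens for arbitrarily large \<open>r\<close>, the covering number divided by \<open>r g(r)\<^sup>t\<close> has lower limit \<open>0\<close>
  for every \<open>t > 0\<close>, because \<open>g\<close> tends to infinity (\<open>growth_rate_eq_0\<close>).

  The heights of the towers need not be unbounded, however: a periodic flow on a circle of length \<open>1\<close>
  is rank one, by towers of height at most \<open>1\<close>.  To reach lengths \<open>r \<ge> R\<close> in every case, the tower is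
  chosen for a partition finer than \<open>P\<close>, whose atoms are the sets of points with a given itinerary, the
  finite list of the colours at times \<open>0, h\<^sub>0, 2h\<^sub>0, \<dots>\<close> up to \<open>R\<close>.  If \<open>\<kappa> H > R\<close>, the argument above applies.
  If \<open>\<kappa> H \<le> R\<close>, take \<open>r = R\<close>: the orbit may leave the tower, but most points of a level share one
  itinerary, and the itinerary determines the name of length \<open>R\<close> up to a small error
  (\<open>name_dist_le_itinerary\<close>).  The number of balls is again about \<open>H / h\<^sub>0 \<le> R / (\<kappa> h\<^sub>0)\<close>.

  The centres of the balls are found by averaging.  The tower is cut into slabs of thickness at most
  \<open>h\<^sub>0\<close>.  The mean distance of the names of two random points of one slab is bounded by two integrals,
  one comparing points of the same level, the other comparing points of the same fibre
  (\<open>slab_pairwise_distance\<close>); and a measure with small mean distance gives most of its mass to a ball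
  about one of its points (\<open>concentration\<close>).  This uses of the tower only a measure \<open>W\<close> on its base, the
  fact that moving \<open>W\<close> along the flow for times in \<open>[0, H)\<close> yields a measure below that of the phase
  space, and the colours of the levels (\<open>tower_base_measure\<close>, \<open>rank_one_tower\<close>).
\<close>

section \<open>Continuity of a measurable flow\<close>

text \<open>
  Up to small measure, \<open>S\<close> agrees with a compact set and with an open set containing it; the compact set
  has a positive distance from the complement of the open one.
\<close>
lemma translation_escape:
  fixes S :: "real set" and e :: real
  assumes S: "S \<in> sets borel" "emeasure lborel S < \<infinity>" and e: "0 < e"
  shows "\<exists>h0>0. \<forall>v. \<bar>v\<bar> < h0 \<longrightarrow> emeasure lborel {s \<in> S. s + v \<notin> S} \<le> ennreal e"
proof -
  have "0 < e / 3" using e by simp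
  have "S \<in> sets borel" "- S \<in> sets borel" using S by auto
  with outer_regular_lborel[OF _ \<open>0 < e / 3\<close>] obtain U V
    where U: "open U" "S \<subseteq> U" "emeasure lborel (U - S) < ennreal (e/3)"
      and V: "open V" "- S \<subseteq> V" "emeasure lborel (V - - S) < ennreal (e/3)"
    by metis
  define C where "C = - V"
  have C: "closed C" "C \<subseteq> S" "emeasure lborel (S - C) < ennreal (e/3)"
    using V by (auto simp: C_def Diff_eq Int_commute)
  have bor[measurable]: "S \<in> sets borel" "U \<in> sets borel" "C \<in> sets borel" using S U C by auto
  \<comment> \<open>Cutting off the part far from the origin leaves a compact set.\<close>
  have "(\<lambda>n. emeasure lborel (S - cball 0 (real n))) \<longlonglongrightarrow> emeasure lborel (\<Inter>n. S - cball 0 (real n))"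
  proof (rule Lim_emeasure_decseq)
    show "decseq (\<lambda>n. S - cball 0 (real n))" by (auto simp: decseq_def)
    show "emeasure lborel (S - cball 0 (real n)) \<noteq> \<infinity>" for n
      using S(2) emeasure_mono[of "S - cball 0 (real n)" S lborel] by (auto simp: top_unique)
  qed auto
  moreover have "(\<Inter>n. S - cball 0 (real n)) = {}"
    using real_arch_simple by (auto simp: dist_real_def)
  ultimately have "(\<lambda>n. emeasure lborel (S - cball 0 (real n))) \<longlonglongrightarrow> 0"
    by (metis emeasure_empty)
  then have "\<forall>\<^sub>F n in sequentially. emeasure lborel (S - cball 0 (real n)) < ennreal (e/3)"
    using e by (intro order_tendstoD(2)) auto
  then obtain n where n: "emeasure lborel (S - cball 0 (real n)) < ennreal (e/3)"
    by (auto simp: eventually_sequentially)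
  define K where "K = C \<inter> cball 0 (real n)"
  have K: "compact K" "K \<subseteq> U" unfolding K_def using C U by (auto simp: closed_Int_compact)
  then have "\<exists>h0>0. \<forall>x\<in>K. \<forall>y\<in>-U. h0 \<le> dist x y"
    using separate_compact_closed[of K "- U"] U(1) by auto
  then obtain h0 where h0: "h0 > 0" "\<And>x y. x \<in> K \<Longrightarrow> y \<notin> U \<Longrightarrow> h0 \<le> dist x y" by auto
  show ?thesis
  proof (intro exI[of _ h0] conjI allI impI)
    fix v :: real assume v: "\<bar>v\<bar> < h0"
    have shift: "emeasure lborel {s. s + v \<in> U - S} = emeasure lborel (U - S)"
    proof -
      have "emeasure lborel (U - S) = emeasure (distr lborel borel (\<lambda>x. v + x)) (U - S)"
        using lborel_distr_plus[of v] by simp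
      also have "\<dots> = emeasure lborel {s. s + v \<in> U - S}"
        by (subst emeasure_distr) (auto simp: vimage_def add.commute)
      finally show ?thesis ..
    qed
    have "{s \<in> S. s + v \<notin> S} \<subseteq> ((S - C) \<union> (S - cball 0 (real n))) \<union> {s. s + v \<in> U - S}"
    proof (rule subsetI, rule ccontr)
      fix s assume "s \<in> {s \<in> S. s + v \<notin> S}" "s \<notin> (S - C) \<union> (S - cball 0 (real n)) \<union> {s. s + v \<in> U - S}"
      then have "h0 \<le> dist s (s + v)" by (intro h0(2)) (auto simp: K_def)
      then show False using v by (simp add: dist_real_def)
    qed
    then have "emeasure lborel {s \<in> S. s + v \<notin> S}
        \<le> emeasure lborel (((S - C) \<union> (S - cball 0 (real n))) \<union> {s. s + v \<in> U - S})"
      by (intro emeasure_mono) auto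
    also have "\<dots> \<le> emeasure lborel ((S - C) \<union> (S - cball 0 (real n))) + emeasure lborel {s. s + v \<in> U - S}"
      by (intro emeasure_subadditive) auto
    also have "\<dots> \<le> (emeasure lborel (S - C) + emeasure lborel (S - cball 0 (real n))) + emeasure lborel (U - S)"
      unfolding shift by (intro add_mono emeasure_subadditive) auto
    also have "\<dots> \<le> (ennreal (e/3) + ennreal (e/3)) + ennreal (e/3)"
      by (intro add_mono order.strict_implies_order[OF C(3)] order.strict_implies_order[OF n]
          order.strict_implies_order[OF U(3)])
    also have "\<dots> = ennreal e" using e by (simp flip: ennreal_plus)
    finally show "emeasure lborel {s \<in> S. s + v \<notin> S} \<le> ennreal e" .
  qed (use h0 in auto)
qed

context measure_preserving_flow
begin

lemma measurable_flow [measurable (raw)]: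
  assumes "f \<in> borel_measurable L" "g \<in> L \<rightarrow>\<^sub>M M"
  shows "(\<lambda>z. T (f z) (g z)) \<in> L \<rightarrow>\<^sub>M M"
  using measurable_compose[OF measurable_Pair[OF assms] flow_measurable] by simp

lemma flow_in_space [simp, intro]: "x \<in> space M \<Longrightarrow> T t x \<in> space M"
  using measurable_space[OF measurable_flow[of "\<lambda>_. t" M "\<lambda>x. x"]] by auto

lemma nn_integral_flow:
  assumes [measurable]: "f \<in> borel_measurable M"
  shows "(\<integral>\<^sup>+x. f (T t x) \<partial>M) = (\<integral>\<^sup>+x. f x \<partial>M)"
proof -
  have "(\<integral>\<^sup>+x. f x \<partial>M) = (\<integral>\<^sup>+x. f x \<partial>distr M M (T t))" by (simp add: flow_preserving)
  also have "\<dots> = (\<integral>\<^sup>+x. f (T t x) \<partial>M)" by (subst nn_integral_distr) auto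
  finally show ?thesis ..
qed

text \<open>
  By invariance and Tonelli's theorem, the measure in question is the mean over \<open>x\<close> of the measure of
  the times \<open>s\<close> in \<open>[0, 1]\<close> with \<open>T\<^sub>s x\<close> in \<open>A\<close> and \<open>T\<^sub>s\<^sub>+\<^sub>v x\<close> outside.  That is a question about
  translations of a subset of the line, one orbit at a time.
\<close>
lemma flow_escape:
  assumes A[measurable]: "A \<in> sets M"
  shows "((\<lambda>v. emeasure M {x \<in> space M. x \<in> A \<and> T v x \<notin> A}) \<longlongrightarrow> 0) (at 0)"
proof -
  define G where "G v x = emeasure lborel {s. 0 \<le> s \<and> s \<le> 1 \<and> T s x \<in> A \<and> T (s + v) x \<notin> A}" for v x
  have G_alt: "G v x = (\<integral>\<^sup>+s. (if 0 \<le> s \<and> s \<le> 1 \<and> T s x \<in> A \<and> T (s + v) x \<notin> A then 1 else 0) \<partial>lborel)"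
    if "x \<in> space M" for v x
  proof -
    have "{s \<in> space lborel. 0 \<le> s \<and> s \<le> 1 \<and> T s x \<in> A \<and> T (s + v) x \<notin> A} \<in> sets lborel"
      using that by measurable
    then have "G v x = (\<integral>\<^sup>+s. indicator {s. 0 \<le> s \<and> s \<le> 1 \<and> T s x \<in> A \<and> T (s + v) x \<notin> A} s \<partial>lborel)"
      unfolding G_def by (subst nn_integral_indicator) auto
    then show ?thesis by (simp add: indicator_def of_bool_def)
  qed
  have meas[measurable]: "G v \<in> borel_measurable M" for v
    by (subst measurable_cong[OF G_alt]) auto
  have G1: "G v x \<le> 1" for v x
  proof -
    have "G v x \<le> emeasure lborel {0..1::real}"
      unfolding G_def by (intro emeasure_mono) auto
    then show ?thesis by simp
  qed
  have D: "emeasure M {x \<in> space M. x \<in> A \<and> T v x \<notin> A} = (\<integral>\<^sup>+x. G v x \<partial>M)" for v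
  proof -
    interpret pair_sigma_finite lborel M ..
    have "(\<integral>\<^sup>+x. G v x \<partial>M) = (\<integral>\<^sup>+x. \<integral>\<^sup>+s. indicator {0..1} s *
        (if T s x \<in> A \<and> T v (T s x) \<notin> A then 1 else 0) \<partial>lborel \<partial>M)"
      by (intro nn_integral_cong) (auto simp: G_alt flow_add[symmetric] add.commute indicator_def intro!: nn_integral_cong)
    also have "\<dots> = (\<integral>\<^sup>+s. \<integral>\<^sup>+x. indicator {0..1} s *
        (if T s x \<in> A \<and> T v (T s x) \<notin> A then 1 else 0) \<partial>M \<partial>lborel)"
      by (intro Fubini') measurable
    also have "\<dots> = (\<integral>\<^sup>+s. indicator {0..1::real} s * (\<integral>\<^sup>+x. (if x \<in> A \<and> T v x \<notin> A then 1 else 0) \<partial>M) \<partial>lborel)"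
    proof (rule nn_integral_cong)
      fix s :: real
      have "(\<integral>\<^sup>+x. indicator {0..1} s * (if T s x \<in> A \<and> T v (T s x) \<notin> A then 1 else 0) \<partial>M)
          = indicator {0..1} s * (\<integral>\<^sup>+x. (if T s x \<in> A \<and> T v (T s x) \<notin> A then 1 else 0) \<partial>M)"
        by (rule nn_integral_cmult) measurable
      also have "(\<integral>\<^sup>+x. (if T s x \<in> A \<and> T v (T s x) \<notin> A then 1 else 0) \<partial>M)
          = (\<integral>\<^sup>+x. (if x \<in> A \<and> T v x \<notin> A then 1 else 0 :: ennreal) \<partial>M)"
        by (rule nn_integral_flow) measurable
      finally show "(\<integral>\<^sup>+x. indicator {0..1} s * (if T s x \<in> A \<and> T v (T s x) \<notin> A then 1 else 0) \<partial>M)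
          = indicator {0..1} s * (\<integral>\<^sup>+x. (if x \<in> A \<and> T v x \<notin> A then 1 else 0) \<partial>M)" .
    qed
    also have "\<dots> = (\<integral>\<^sup>+x. (if x \<in> A \<and> T v x \<notin> A then 1 else 0) \<partial>M)"
      by (subst nn_integral_multc) auto
    also have "\<dots> = (\<integral>\<^sup>+x. indicator {x \<in> space M. x \<in> A \<and> T v x \<notin> A} x \<partial>M)"
      by (intro nn_integral_cong) (auto simp: indicator_def)
    also have "\<dots> = emeasure M {x \<in> space M. x \<in> A \<and> T v x \<notin> A}"
      by (rule nn_integral_indicator) measurable
    finally show ?thesis ..
  qed
  have ptw: "((\<lambda>v. G v x) \<longlongrightarrow> 0) (at 0)" if x: "x \<in> space M" for x
  proof (rule order_tendstoI)
    fix a :: ennreal assume "0 < a"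
    then obtain e where e: "0 < e" "ennreal e < a"
      by (metis dense ennreal_less_zero_iff less_top_ennreal order_less_le_trans top_greatest
          ennreal_cases ennreal_less_top not_less_iff_gr_or_eq)
    \<comment> \<open>Enlarging \<open>[0, 1]\<close> by \<open>1\<close> on both sides keeps \<open>s + v\<close> in range when \<open>\<bar>v\<bar> < 1\<close>.\<close>
    define S where "S = {s. -1 \<le> s \<and> s \<le> 2 \<and> T s x \<in> A}"
    have "{s \<in> space lborel. -1 \<le> s \<and> s \<le> 2 \<and> T s x \<in> A} \<in> sets lborel"
      using x by measurable
    then have S[measurable]: "S \<in> sets borel" by (simp add: S_def)
    have "emeasure lborel S \<le> emeasure lborel {-1..2::real}"
      by (intro emeasure_mono) (auto simp: S_def)
    also have "\<dots> < \<infinity>" by simp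
    finally obtain h0 where h0: "h0 > 0" "\<And>v. \<bar>v\<bar> < h0 \<Longrightarrow> emeasure lborel {s \<in> S. s + v \<notin> S} \<le> ennreal e"
      using translation_escape[OF S _ e(1)] by auto
    have "G v x < a" if v: "v \<noteq> 0" "dist v 0 < min h0 1" for v
    proof -
      have "{s \<in> space borel. s \<in> S \<and> s + v \<notin> S} \<in> sets borel" by measurable
      then have "{s \<in> S. s + v \<notin> S} \<in> sets lborel" by simp
      moreover have "{s. 0 \<le> s \<and> s \<le> 1 \<and> T s x \<in> A \<and> T (s + v) x \<notin> A} \<subseteq> {s \<in> S. s + v \<notin> S}"
        using v by (auto simp: S_def dist_real_def)
      ultimately have "G v x \<le> emeasure lborel {s \<in> S. s + v \<notin> S}"
        unfolding G_def by (intro emeasure_mono)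
      also have "\<dots> \<le> ennreal e" using v by (intro h0) (auto simp: dist_real_def)
      finally show ?thesis using e by order
    qed
    then show "\<forall>\<^sub>F v in at 0. G v x < a"
      unfolding eventually_at using h0(1) by (intro exI[of _ "min h0 1"]) auto
  qed auto
  show ?thesis
    unfolding D
  proof (subst tendsto_at_iff_sequentially, safe, unfold comp_def)
    fix X :: "nat \<Rightarrow> real" assume X: "\<forall>i. X i \<in> UNIV - {0}" "X \<longlonglongrightarrow> 0"
    have "(\<lambda>n. \<integral>\<^sup>+x. G (X n) x \<partial>M) \<longlonglongrightarrow> (\<integral>\<^sup>+x. 0 \<partial>M)"
    proof (rule nn_integral_dominated_convergence[where w="\<lambda>_. 1"])
      show "AE x in M. (\<lambda>n. G (X n) x) \<longlonglongrightarrow> 0"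
        using ptw X by (auto simp: tendsto_at_iff_sequentially comp_def)
      show "AE x in M. G (X n) x \<le> 1" for n using G1 by auto
    qed (auto simp: emeasure_space_1)
    then show "(\<lambda>n. \<integral>\<^sup>+x. G (X n) x \<partial>M) \<longlonglongrightarrow> 0" by simp
  qed
qed

end

section \<open>Lebesgue measure on an interval\<close>

text \<open>
  A density is used in place of a restricted space, so that the underlying space is always the whole
  line and measurability does not depend on the interval.
\<close>
definition window :: "real \<Rightarrow> real \<Rightarrow> real measure" where
  "window a b = density lborel (indicator {a..<b})"

lemma sets_window [simp, measurable_cong]: "sets (window a b) = sets borel"
  by (simp add: window_def)

lemma space_window [simp]: "space (window a b) = UNIV"
  by (simp add: window_def)

lemma nn_integral_window:
  "f \<in> borel_measurable borel \<Longrightarrow> (\<integral>\<^sup>+s. f s \<partial>window a b) = (\<integral>\<^sup>+s. f s * indicator {a..<b} s \<partial>lborel)"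
  unfolding window_def by (subst nn_integral_density) (auto simp: mult.commute)

lemma emeasure_window: "A \<in> sets borel \<Longrightarrow> emeasure (window a b) A = emeasure lborel ({a..<b} \<inter> A)"
  unfolding window_def by (subst emeasure_density) (auto simp: indicator_inter_arith[symmetric])

lemma emeasure_window_UNIV [simp]: "a \<le> b \<Longrightarrow> emeasure (window a b) UNIV = ennreal (b - a)"
  by (subst emeasure_window) auto

lemma finite_measure_window [simp, intro]: "finite_measure (window a b)"
proof
  show "emeasure (window a b) (space (window a b)) \<noteq> \<infinity>"
    by (cases "a \<le> b") (auto simp: emeasure_window)
qed

lemma sigma_finite_window [simp, intro]: "sigma_finite_measure (window a b)"
  using finite_measure.axioms finite_measure_window by blast

lemma AE_window: "AE s in window a b. a \<le> s \<and> s < b"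
  unfolding window_def by (subst AE_density) (auto simp: indicator_def)

lemma nn_integral_window_join:
  assumes "f \<in> borel_measurable borel" "a \<le> b" "b \<le> c"
  shows "(\<integral>\<^sup>+s. f s \<partial>window a c) = (\<integral>\<^sup>+s. f s \<partial>window a b) + (\<integral>\<^sup>+s. f s \<partial>window b c)"
  using assms
  by (auto simp: nn_integral_window nn_integral_add[symmetric] indicator_def intro!: nn_integral_cong)

lemma nn_integral_window_mono:
  assumes "f \<in> borel_measurable borel" "a' \<le> a" "b \<le> b'"
  shows "(\<integral>\<^sup>+s. f s \<partial>window a b) \<le> (\<integral>\<^sup>+s. f s \<partial>window a' b')"
  using assms by (auto simp: nn_integral_window indicator_def intro!: nn_integral_mono)

lemma nn_integral_window_shift:
  assumes [measurable]: "f \<in> borel_measurable borel"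
  shows "(\<integral>\<^sup>+s. f s \<partial>window a b) = (\<integral>\<^sup>+v. f (t + v) \<partial>window (a - t) (b - t))"
proof -
  have "(\<integral>\<^sup>+s. f s \<partial>window a b) = (\<integral>\<^sup>+s. f s * indicator {a..<b} s \<partial>distr lborel borel (\<lambda>x. t + x))"
    by (simp add: nn_integral_window lborel_distr_plus)
  also have "\<dots> = (\<integral>\<^sup>+v. f (t + v) * indicator {a..<b} (t + v) \<partial>lborel)"
    by (subst nn_integral_distr) auto
  also have "\<dots> = (\<integral>\<^sup>+v. f (t + v) \<partial>window (a - t) (b - t))"
    by (subst nn_integral_window) (auto intro!: nn_integral_cong simp: indicator_def)
  finally show ?thesis .
qed

lemma sum_window_partition:
  assumes f: "f \<in> borel_measurable borel" and h: "0 \<le> h"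
  shows "(\<Sum>j<J. \<integral>\<^sup>+s. f s \<partial>window (real j * h) (real (Suc j) * h)) = (\<integral>\<^sup>+s. f s \<partial>window 0 (real J * h))"
proof (induction J)
  case 0
  then show ?case using f by (simp add: nn_integral_window)
next
  case (Suc J)
  then show ?case
    using nn_integral_window_join[OF f, of 0 "real J * h" "real (Suc J) * h"] h
    by (simp add: mult_right_mono)
qed

section \<open>Small mean distance forces concentration\<close>

lemma (in finite_measure) exists_le_average:
  assumes f[measurable]: "f \<in> borel_measurable M" and pos: "emeasure M (space M) \<noteq> 0"
  shows "\<exists>x\<in>space M. emeasure M (space M) * f x \<le> (\<integral>\<^sup>+x. f x \<partial>M)"
proof (rule ccontr)
  define m where "m = emeasure M (space M)"
  define I where "I = (\<integral>\<^sup>+x. f x \<partial>M)"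
  assume "\<not> ?thesis"
  then have less: "I < m * f x" if "x \<in> space M" for x
    using that by (auto simp: m_def I_def not_le)
  have "space M \<noteq> {}" using pos by auto
  then have I: "I \<noteq> \<infinity>" using less by (force simp: less_top)
  have m: "m \<noteq> \<infinity>" by (simp add: m_def emeasure_finite)
  have "(\<integral>\<^sup>+x. m * f x - I \<partial>M) = (\<integral>\<^sup>+x. m * f x \<partial>M) - (\<integral>\<^sup>+x. I \<partial>M)"
    using I m less by (intro nn_integral_diff) (auto simp: ennreal_mult_eq_top_iff m_def order.strict_implies_order)
  also have "\<dots> = 0"
    using I m by (simp add: nn_integral_cmult I_def[symmetric] m_def[symmetric] mult.commute ennreal_mult_eq_top_iff)
  finally have "AE x in M. m * f x - I = 0"
    by (subst (asm) nn_integral_0_iff_AE) auto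
  moreover have "AE x in M. m * f x - I \<noteq> 0"
    using less by (intro AE_I2) (auto simp: diff_eq_0_iff_ennreal not_le)
  ultimately have "AE x in M. False" by eventually_elim auto
  then show False using pos by (simp add: AE_iff_null null_sets_def)
qed

text \<open>
  Some \<open>x\<close> has at most the average mean distance to the other points, and Markov's inequality for the
  distance to this \<open>x\<close> gives the claim.
\<close>
lemma (in finite_measure) concentration:
  fixes \<rho> :: "'a \<Rightarrow> 'a \<Rightarrow> ennreal"
  assumes [measurable]: "(\<lambda>(x, y). \<rho> x y) \<in> borel_measurable (M \<Otimes>\<^sub>M M)" and pos: "emeasure M (space M) \<noteq> 0"
  shows "\<exists>x\<in>space M. emeasure M (space M) * (\<theta> * emeasure M {y \<in> space M. \<theta> \<le> \<rho> x y})
     \<le> (\<integral>\<^sup>+x. \<integral>\<^sup>+y. \<rho> x y \<partial>M \<partial>M)"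
proof -
  have "\<exists>x\<in>space M. emeasure M (space M) * (\<integral>\<^sup>+y. \<rho> x y \<partial>M) \<le> (\<integral>\<^sup>+x. \<integral>\<^sup>+y. \<rho> x y \<partial>M \<partial>M)"
    by (intro exists_le_average pos) measurable
  then obtain x where x: "x \<in> space M" "emeasure M (space M) * (\<integral>\<^sup>+y. \<rho> x y \<partial>M) \<le> (\<integral>\<^sup>+x. \<integral>\<^sup>+y. \<rho> x y \<partial>M \<partial>M)"
    by blast
  have [measurable]: "\<rho> x \<in> borel_measurable M"
    using measurable_compose[OF measurable_Pair1'[OF x(1)] assms(1)] by simp
  have "\<theta> * emeasure M {y \<in> space M. \<theta> \<le> \<rho> x y} = (\<integral>\<^sup>+y. \<theta> * indicator {y \<in> space M. \<theta> \<le> \<rho> x y} y \<partial>M)"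
    by (subst nn_integral_cmult_indicator) auto
  also have "\<dots> \<le> (\<integral>\<^sup>+y. \<rho> x y \<partial>M)"
    by (intro nn_integral_mono) (auto simp: indicator_def)
  finally show ?thesis
    using x by (intro bexI[of _ x] order_trans[OF mult_left_mono x(2)]) auto
qed

section \<open>Names of a coloured flow\<close>

lemma measurable_of_bool_neq:
  fixes f g :: "'a \<Rightarrow> 'b::countable"
  assumes "f \<in> L \<rightarrow>\<^sub>M count_space UNIV" "g \<in> L \<rightarrow>\<^sub>M count_space UNIV"
  shows "(\<lambda>z. of_bool (f z \<noteq> g z) :: ennreal) \<in> borel_measurable L"
proof -
  have "(\<lambda>z. (f z, g z)) \<in> L \<rightarrow>\<^sub>M count_space UNIV \<Otimes>\<^sub>M count_space UNIV"
    by (intro measurable_Pair assms)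
  then have "(\<lambda>z. (f z, g z)) \<in> L \<rightarrow>\<^sub>M count_space UNIV"
    by (simp add: pair_measure_countable)
  from measurable_compose[OF this, of "\<lambda>(i, j). of_bool (i \<noteq> j)" borel]
  show ?thesis by simp
qed

text \<open>
  A colour function replaces the labelled partition; its fibres are the atoms.
\<close>
locale coloured_flow = measure_preserving_flow M T for M :: "'a measure" and T +
  fixes c :: "'a \<Rightarrow> nat"
  assumes c_measurable [measurable]: "c \<in> M \<rightarrow>\<^sub>M count_space UNIV"
    and finite_colours: "finite (c ` space M)"
begin

definition disagree :: "'a \<Rightarrow> 'a \<Rightarrow> ennreal" where
  "disagree x y = of_bool (c x \<noteq> c y)"

text \<open>
  This is \<open>r\<close> times the Hamming distance of the names of length \<open>r\<close>; without the normalisation it is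
  an integral over time, to which Tonelli's theorem applies directly.
\<close>
definition name_dist :: "real \<Rightarrow> 'a \<Rightarrow> 'a \<Rightarrow> ennreal" where
  "name_dist r x y = (\<integral>\<^sup>+\<tau>. disagree (T \<tau> x) (T \<tau> y) \<partial>window 0 r)"

lemma measurable_disagree [measurable (raw)]:
  assumes "f \<in> L \<rightarrow>\<^sub>M M" "g \<in> L \<rightarrow>\<^sub>M M"
  shows "(\<lambda>z. disagree (f z) (g z)) \<in> borel_measurable L"
  unfolding disagree_def
  by (intro measurable_of_bool_neq measurable_compose[OF _ c_measurable] assms)

lemma measurable_name_dist [measurable (raw)]:
  assumes [measurable]: "f \<in> L \<rightarrow>\<^sub>M M" "g \<in> L \<rightarrow>\<^sub>M M"
  shows "(\<lambda>z. name_dist r (f z) (g z)) \<in> borel_measurable L"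
proof -
  interpret W: sigma_finite_measure "window 0 r" by simp
  show ?thesis unfolding name_dist_def by measurable
qed

lemma disagree_triangle: "disagree x z \<le> disagree x y + disagree y z"
  by (auto simp: disagree_def)

lemma measurable_orbit: "x \<in> space M \<Longrightarrow> (\<lambda>\<tau>. T \<tau> x) \<in> borel \<rightarrow>\<^sub>M M"
  by measurable

lemma name_dist_triangle:
  assumes "x \<in> space M" "y \<in> space M" "z \<in> space M"
  shows "name_dist r x z \<le> name_dist r x y + name_dist r y z"
  unfolding name_dist_def using assms
  by (subst nn_integral_add[symmetric]) (auto intro!: nn_integral_mono disagree_triangle)

text \<open>
  Each time \<open>\<tau>\<close> contributes the same amount, because \<open>T\<^sub>\<tau>\<close> preserves the measure.
\<close>
lemma nn_integral_name_dist_shift: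
  assumes "0 \<le> r"
  shows "(\<integral>\<^sup>+x. name_dist r x (T v x) \<partial>M) = ennreal r * (\<integral>\<^sup>+x. disagree x (T v x) \<partial>M)"
proof -
  interpret pair_sigma_finite "window 0 r" M
    by (simp add: pair_sigma_finite_def sigma_finite_measure_axioms)
  have "(\<integral>\<^sup>+x. name_dist r x (T v x) \<partial>M) = (\<integral>\<^sup>+x. \<integral>\<^sup>+\<tau>. disagree (T \<tau> x) (T v (T \<tau> x)) \<partial>window 0 r \<partial>M)"
    unfolding name_dist_def
    by (intro nn_integral_cong) (auto simp: flow_add[symmetric] add.commute)
  also have "\<dots> = (\<integral>\<^sup>+\<tau>. \<integral>\<^sup>+x. disagree (T \<tau> x) (T v (T \<tau> x)) \<partial>M \<partial>window 0 r)"
    by (intro Fubini') measurable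
  also have "\<dots> = (\<integral>\<^sup>+\<tau>. \<integral>\<^sup>+x. disagree x (T v x) \<partial>M \<partial>window 0 r)"
    by (intro nn_integral_cong nn_integral_flow) measurable
  finally show ?thesis using assms by (simp add: mult.commute)
qed

text \<open>
  If the colour changes between times \<open>0\<close> and \<open>v\<close>, the orbit leaves the atom in which it started; so
  finitely many applications of \<open>flow_escape\<close> suffice.
\<close>
lemma colour_continuity:
  assumes "0 < \<xi>"
  shows "\<exists>h0>0. \<forall>v. \<bar>v\<bar> \<le> h0 \<longrightarrow> (\<integral>\<^sup>+x. disagree x (T v x) \<partial>M) \<le> ennreal \<xi>"
proof -
  let ?A = "\<lambda>i. c -` {i} \<inter> space M"
  have bound: "(\<integral>\<^sup>+x. disagree x (T v x) \<partial>M)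
      \<le> (\<Sum>i\<in>c ` space M. emeasure M {x \<in> space M. x \<in> ?A i \<and> T v x \<notin> ?A i})" for v
  proof -
    have "(\<integral>\<^sup>+x. disagree x (T v x) \<partial>M)
      = (\<integral>\<^sup>+x. (\<Sum>i\<in>c ` space M. indicator {x \<in> space M. x \<in> ?A i \<and> T v x \<notin> ?A i} x) \<partial>M)"
    proof (intro nn_integral_cong)
      fix x assume x: "x \<in> space M"
      have "(\<Sum>i\<in>c ` space M. indicator {x \<in> space M. x \<in> ?A i \<and> T v x \<notin> ?A i} x)
          = (\<Sum>i\<in>c ` space M. if i = c x then disagree x (T v x) else 0)"
        using x by (intro sum.cong) (auto simp: indicator_def disagree_def)
      then show "disagree x (T v x) = (\<Sum>i\<in>c ` space M. indicator {x \<in> space M. x \<in> ?A i \<and> T v x \<notin> ?A i} x)"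
        using x finite_colours by simp
    qed
    also have "\<dots> = (\<Sum>i\<in>c ` space M. emeasure M {x \<in> space M. x \<in> ?A i \<and> T v x \<notin> ?A i})"
      by (subst nn_integral_sum) auto
    finally show ?thesis by simp
  qed
  have "((\<lambda>v. \<Sum>i\<in>c ` space M. emeasure M {x \<in> space M. x \<in> ?A i \<and> T v x \<notin> ?A i}) \<longlongrightarrow> (\<Sum>i\<in>c ` space M. 0)) (at 0)"
    by (intro tendsto_sum flow_escape) measurable
  then have "\<forall>\<^sub>F v in at 0. (\<Sum>i\<in>c ` space M. emeasure M {x \<in> space M. x \<in> ?A i \<and> T v x \<notin> ?A i}) < ennreal \<xi>"
    using assms by (intro order_tendstoD(2)) auto
  then obtain d where d: "d > 0" "\<And>v. v \<noteq> 0 \<Longrightarrow> \<bar>v\<bar> < d \<Longrightarrow>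
      (\<Sum>i\<in>c ` space M. emeasure M {x \<in> space M. x \<in> ?A i \<and> T v x \<notin> ?A i}) < ennreal \<xi>"
    by (auto simp: eventually_at dist_real_def)
  have "(\<integral>\<^sup>+x. disagree x (T v x) \<partial>M) \<le> ennreal \<xi>" if v: "\<bar>v\<bar> \<le> d / 2" for v
  proof (cases "v = 0")
    case True
    have "(\<integral>\<^sup>+x. disagree x (T v x) \<partial>M) = (\<integral>\<^sup>+x. 0 \<partial>M)"
      using True by (intro nn_integral_cong) (auto simp: flow_zero disagree_def)
    then show ?thesis by simp
  next
    case False
    then show ?thesis using d(2)[of v] bound[of v] v d(1) by (auto intro: order_trans order.strict_implies_order)
  qed
  then show ?thesis using d(1) by (intro exI[of _ "d / 2"]) auto
qed

end

section \<open>Slabs over a base measure\<close>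

text \<open>
  In the applications \<open>W\<close> lives on the base of a tower, regarded as a subset of the phase space.  Only its total
  mass and its images under the flow matter, so the base itself is not mentioned.
\<close>
locale flow_over_base = coloured_flow M T c + W: finite_measure W
    for M :: "'a measure" and T c and W :: "'a measure" +
  assumes sets_W [measurable_cong]: "sets W = sets M"
begin

lemma space_W: "space W = space M"
  using sets_W by (rule sets_eq_imp_space_eq)

text \<open>
  The part of the tower between heights \<open>a\<close> and \<open>b\<close>, as a measure on the phase space.
\<close>
definition slab :: "real \<Rightarrow> real \<Rightarrow> 'a measure" where
  "slab a b = distr (window a b \<Otimes>\<^sub>M W) M (\<lambda>(s, y). T s y)"

lemma sets_slab [simp, measurable_cong]: "sets (slab a b) = sets M"
  by (simp add: slab_def)

lemma space_slab [simp]: "space (slab a b) = space M"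
  by (simp add: slab_def)

lemma nn_integral_slab:
  assumes [measurable]: "f \<in> borel_measurable M"
  shows "(\<integral>\<^sup>+x. f x \<partial>slab a b) = (\<integral>\<^sup>+s. \<integral>\<^sup>+y. f (T s y) \<partial>W \<partial>window a b)"
proof -
  have "(\<integral>\<^sup>+x. f x \<partial>slab a b) = (\<integral>\<^sup>+z. f (case z of (s, y) \<Rightarrow> T s y) \<partial>(window a b \<Otimes>\<^sub>M W))"
    unfolding slab_def by (rule nn_integral_distr) measurable
  also have "\<dots> = (\<integral>\<^sup>+s. \<integral>\<^sup>+y. f (T s y) \<partial>W \<partial>window a b)"
    by (subst W.nn_integral_fst[symmetric]) auto
  finally show ?thesis .
qed

lemma emeasure_slab:
  assumes [measurable]: "A \<in> sets M"
  shows "emeasure (slab a b) A = (\<integral>\<^sup>+s. \<integral>\<^sup>+y. indicator A (T s y) \<partial>W \<partial>window a b)"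
proof -
  have "emeasure (slab a b) A = (\<integral>\<^sup>+x. indicator A x \<partial>slab a b)" by simp
  also have "\<dots> = (\<integral>\<^sup>+s. \<integral>\<^sup>+y. indicator A (T s y) \<partial>W \<partial>window a b)"
    by (rule nn_integral_slab) measurable
  finally show ?thesis .
qed

lemma emeasure_slab_space:
  assumes "a \<le> b"
  shows "emeasure (slab a b) (space M) = ennreal (b - a) * emeasure W (space M)"
proof -
  have "(\<integral>\<^sup>+y. indicator (space M) (T s y) \<partial>W) = (\<integral>\<^sup>+y. 1 \<partial>W)" for s
    by (rule nn_integral_cong) (simp add: space_W)
  then have "emeasure (slab a b) (space M) = (\<integral>\<^sup>+s. \<integral>\<^sup>+y. 1 \<partial>W \<partial>window a b)"
    unfolding emeasure_slab[OF sets.top] by presburger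
  then show ?thesis using assms by (simp add: space_W mult.commute)
qed

lemma finite_measure_slab: "finite_measure (slab a b)"
proof -
  interpret pair_sigma_finite "window a b" W
    by (simp add: pair_sigma_finite_def W.sigma_finite_measure_axioms)
  have "(\<integral>\<^sup>+y. indicator (space M) (T s y) \<partial>W) = (\<integral>\<^sup>+y. 1 \<partial>W)" for s
    by (rule nn_integral_cong) (simp add: space_W)
  then have "emeasure (slab a b) (space M) = (\<integral>\<^sup>+s. \<integral>\<^sup>+y. 1 \<partial>W \<partial>window a b)"
    unfolding emeasure_slab[OF sets.top] by presburger
  then have "emeasure (slab a b) (space M) = emeasure (window a b) UNIV * emeasure W (space W)"
    by (simp add: mult.commute)
  also have "\<dots> < \<infinity>"
    using finite_measure.emeasure_finite[OF finite_measure_window, of a b UNIV] W.emeasure_finite[of "space W"]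
    by (auto simp: less_top[symmetric] ennreal_mult_eq_top_iff)
  finally show ?thesis by (intro finite_measureI) auto
qed

lemma nn_integral_slab_partition:
  assumes [measurable]: "f \<in> borel_measurable M" and "0 \<le> h"
  shows "(\<Sum>j<J. \<integral>\<^sup>+x. f x \<partial>slab (real j * h) (real (Suc j) * h)) = (\<integral>\<^sup>+x. f x \<partial>slab 0 (real J * h))"
  unfolding nn_integral_slab[OF assms(1)]
  by (rule sum_window_partition) (use assms in measurable)

text \<open>
  The two sources of variation inside a slab: how much names differ within one level, and how much the
  name of a point changes when it is moved along its orbit by less than \<open>h\<close>.
\<close>
definition level_spread :: "real \<Rightarrow> real \<Rightarrow> ennreal" where
  "level_spread r s = (\<integral>\<^sup>+y'. \<integral>\<^sup>+y. name_dist r (T s y') (T s y) \<partial>W \<partial>W)"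

definition time_spread :: "real \<Rightarrow> real \<Rightarrow> 'a \<Rightarrow> ennreal" where
  "time_spread r h x = (\<integral>\<^sup>+v. name_dist r x (T v x) \<partial>window (- h) h)"

lemma measurable_level_spread [measurable]: "level_spread r \<in> borel_measurable borel"
  unfolding level_spread_def by measurable

lemma measurable_time_spread [measurable]: "time_spread r h \<in> borel_measurable M"
proof -
  interpret I: sigma_finite_measure "window (- h) h" by simp
  show ?thesis unfolding time_spread_def by measurable
qed

text \<open>
  From \<open>T\<^sub>s y\<close> go first within the level to \<open>T\<^sub>s y'\<close>, then along the fibre to \<open>T\<^sub>s\<^sub>' y'\<close>.  The second
  displacement is less than \<open>b - a\<close>.
\<close>
lemma slab_pairwise_distance:
  assumes ab: "a \<le> b"
  shows "(\<integral>\<^sup>+x. \<integral>\<^sup>+x'. name_dist r x x' \<partial>slab a b \<partial>slab a b)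
    \<le> ennreal (b - a) * (\<integral>\<^sup>+s. level_spread r s \<partial>window a b)
      + emeasure W (space M) * (\<integral>\<^sup>+x. time_spread r (b - a) x \<partial>slab a b)"
proof -
  interpret I: sigma_finite_measure "window a b" by simp
  interpret I': sigma_finite_measure "window (a - b) (b - a)" by simp
  interpret P: pair_sigma_finite "window a b" W
    by (simp add: pair_sigma_finite_def W.sigma_finite_measure_axioms)
  interpret S: finite_measure "slab a b" by (rule finite_measure_slab)
  let ?w = "emeasure W (space M)"
  have inner: "(\<integral>\<^sup>+x'. name_dist r x x' \<partial>slab a b) = (\<integral>\<^sup>+s'. \<integral>\<^sup>+y'. name_dist r x (T s' y') \<partial>W \<partial>window a b)"
    if "x \<in> space M" for x
    by (rule nn_integral_slab) (use that in measurable)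
  have "(\<integral>\<^sup>+x. \<integral>\<^sup>+x'. name_dist r x x' \<partial>slab a b \<partial>slab a b)
      = (\<integral>\<^sup>+s. \<integral>\<^sup>+y. \<integral>\<^sup>+x'. name_dist r (T s y) x' \<partial>slab a b \<partial>W \<partial>window a b)"
    by (rule nn_integral_slab) measurable
  also have "\<dots> = (\<integral>\<^sup>+s. \<integral>\<^sup>+y. \<integral>\<^sup>+s'. \<integral>\<^sup>+y'. name_dist r (T s y) (T s' y') \<partial>W \<partial>window a b \<partial>W \<partial>window a b)"
    by (intro nn_integral_cong inner) (auto simp: space_W)
  also have "\<dots> \<le> (\<integral>\<^sup>+s. \<integral>\<^sup>+y. \<integral>\<^sup>+s'. \<integral>\<^sup>+y'. name_dist r (T s y) (T s y') + name_dist r (T s y') (T s' y')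
      \<partial>W \<partial>window a b \<partial>W \<partial>window a b)"
    by (intro nn_integral_mono name_dist_triangle) (auto simp: space_W)
  also have "\<dots> = (\<integral>\<^sup>+s. \<integral>\<^sup>+y. \<integral>\<^sup>+s'.
      (\<integral>\<^sup>+y'. name_dist r (T s y) (T s y') \<partial>W) + (\<integral>\<^sup>+y'. name_dist r (T s y') (T s' y') \<partial>W)
      \<partial>window a b \<partial>W \<partial>window a b)"
    by (intro nn_integral_cong nn_integral_add) (auto simp: space_W)
  also have "\<dots> = (\<integral>\<^sup>+s. \<integral>\<^sup>+y.
      ennreal (b - a) * (\<integral>\<^sup>+y'. name_dist r (T s y) (T s y') \<partial>W)
      + (\<integral>\<^sup>+s'. \<integral>\<^sup>+y'. name_dist r (T s y') (T s' y') \<partial>W \<partial>window a b) \<partial>W \<partial>window a b)"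
    using ab by (intro nn_integral_cong) (subst nn_integral_add, auto simp: space_W mult.commute)
  also have "\<dots> = (\<integral>\<^sup>+s. ennreal (b - a) * level_spread r s
      + ?w * (\<integral>\<^sup>+s'. \<integral>\<^sup>+y'. name_dist r (T s y') (T s' y') \<partial>W \<partial>window a b) \<partial>window a b)"
    unfolding level_spread_def
    by (intro nn_integral_cong, subst nn_integral_add)
      (auto simp: space_W mult.commute nn_integral_cmult nn_integral_multc)
  also have "\<dots> = ennreal (b - a) * (\<integral>\<^sup>+s. level_spread r s \<partial>window a b)
      + ?w * (\<integral>\<^sup>+s. \<integral>\<^sup>+s'. \<integral>\<^sup>+y'. name_dist r (T s y') (T s' y') \<partial>W \<partial>window a b \<partial>window a b)"
    by (subst nn_integral_add) (auto simp: nn_integral_cmult)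
  also have "(\<integral>\<^sup>+s. \<integral>\<^sup>+s'. \<integral>\<^sup>+y'. name_dist r (T s y') (T s' y') \<partial>W \<partial>window a b \<partial>window a b)
      = (\<integral>\<^sup>+s. \<integral>\<^sup>+y'. \<integral>\<^sup>+s'. name_dist r (T s y') (T s' y') \<partial>window a b \<partial>W \<partial>window a b)"
    by (intro nn_integral_cong P.Fubini'[symmetric]) (auto simp: space_W)
  also have "\<dots> \<le> (\<integral>\<^sup>+s. \<integral>\<^sup>+y'. time_spread r (b - a) (T s y') \<partial>W \<partial>window a b)"
  proof (rule nn_integral_mono_AE, rule AE_mp[OF AE_window], intro AE_I2 impI nn_integral_mono)
    fix s y assume s: "a \<le> s \<and> s < b" and "y \<in> space W"
    then have y: "y \<in> space M" by (simp add: space_W)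
    have "(\<integral>\<^sup>+s'. name_dist r (T s y) (T s' y) \<partial>window a b)
        = (\<integral>\<^sup>+v. name_dist r (T s y) (T (s + v) y) \<partial>window (a - s) (b - s))"
      by (rule nn_integral_window_shift) (use y in measurable)
    also have "\<dots> \<le> (\<integral>\<^sup>+v. name_dist r (T s y) (T (s + v) y) \<partial>window (- (b - a)) (b - a))"
      using s y by (intro nn_integral_window_mono) auto
    also have "\<dots> = time_spread r (b - a) (T s y)"
      unfolding time_spread_def using y
      by (intro nn_integral_cong) (simp add: flow_add[symmetric] add.commute)
    finally show "(\<integral>\<^sup>+s'. name_dist r (T s y) (T s' y) \<partial>window a b) \<le> time_spread r (b - a) (T s y)" .
  qed
  also have "\<dots> = (\<integral>\<^sup>+x. time_spread r (b - a) x \<partial>slab a b)"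
    by (rule nn_integral_slab[symmetric]) measurable
  finally show ?thesis by (simp add: add_left_mono mult_left_mono)
qed

lemma nn_integral_time_spread:
  assumes r: "0 \<le> r" and h: "0 \<le> h"
    and \<xi>: "\<And>v. \<bar>v\<bar> \<le> h \<Longrightarrow> (\<integral>\<^sup>+x. disagree x (T v x) \<partial>M) \<le> ennreal \<xi>"
  shows "(\<integral>\<^sup>+x. time_spread r h x \<partial>M) \<le> ennreal (2 * h) * (ennreal r * ennreal \<xi>)"
proof -
  interpret P: pair_sigma_finite "window (- h) h" M
    by (simp add: pair_sigma_finite_def sigma_finite_measure_axioms)
  have "(\<integral>\<^sup>+x. time_spread r h x \<partial>M) = (\<integral>\<^sup>+v. \<integral>\<^sup>+x. name_dist r x (T v x) \<partial>M \<partial>window (- h) h)"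
    unfolding time_spread_def by (rule P.Fubini') measurable
  also have "\<dots> \<le> (\<integral>\<^sup>+v. ennreal r * ennreal \<xi> \<partial>window (- h) h)"
  proof (rule nn_integral_mono_AE, rule AE_mp[OF AE_window], intro AE_I2 impI)
    fix v assume "- h \<le> v \<and> v < h"
    then show "(\<integral>\<^sup>+x. name_dist r x (T v x) \<partial>M) \<le> ennreal r * ennreal \<xi>"
      using r by (auto simp: nn_integral_name_dist_shift intro!: mult_left_mono \<xi>)
  qed
  finally show ?thesis using h by (simp add: mult.commute)
qed

text \<open>
  One centre is taken in each of \<open>J\<close> slabs of equal thickness \<open>h\<close>, and the bounds on the slabs are added
  up.  All slabs have the same mass \<open>h W(X)\<close>, which therefore cancels; this is why the slabs must not
  have a shorter remainder at the top.
\<close>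
lemma slab_covering:
  assumes r: "0 \<le> r" and J: "0 < J" and h: "0 < h" and w: "0 < emeasure W (space M)"
    and slab: "\<And>A. A \<in> sets M \<Longrightarrow> emeasure (slab 0 (real J * h)) A \<le> emeasure M A"
    and \<xi>: "\<And>v. \<bar>v\<bar> \<le> h \<Longrightarrow> (\<integral>\<^sup>+x. disagree x (T v x) \<partial>M) \<le> ennreal \<xi>"
    and level: "(\<integral>\<^sup>+s. level_spread r s \<partial>window 0 (real J * h)) \<le> emeasure W (space M) * D"
  shows "\<exists>C. C \<subseteq> space M \<and> finite C \<and> card C \<le> J \<and>
    \<theta> * emeasure (slab 0 (real J * h)) {y \<in> space M. \<forall>x\<in>C. \<theta> \<le> name_dist r x y}
      \<le> D + 2 * (ennreal r * ennreal \<xi>)"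
proof -
  let ?w = "emeasure W (space M)"
  define L where "L j = slab (real j * h) (real (Suc j) * h)" for j
  have L_mass: "emeasure (L j) (space M) = ennreal h * ?w" for j
    using h by (simp add: L_def emeasure_slab_space algebra_simps)
  have "\<exists>x\<in>space M. ennreal h * ?w * (\<theta> * emeasure (L j) {y \<in> space M. \<theta> \<le> name_dist r x y})
     \<le> (\<integral>\<^sup>+x. \<integral>\<^sup>+y. name_dist r x y \<partial>L j \<partial>L j)" for j
  proof -
    interpret L: finite_measure "L j" unfolding L_def by (rule finite_measure_slab)
    have [measurable_cong]: "sets (L j) = sets M" by (simp add: L_def)
    have sp: "space (L j) = space M" by (simp add: L_def)
    have "(\<lambda>(x, y). name_dist r x y) \<in> borel_measurable (L j \<Otimes>\<^sub>M L j)" by measurable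
    from L.concentration[OF this, of \<theta>] show ?thesis using h w by (simp add: sp L_mass)
  qed
  then obtain x where x: "\<And>j. x j \<in> space M"
    "\<And>j. ennreal h * ?w * (\<theta> * emeasure (L j) {y \<in> space M. \<theta> \<le> name_dist r (x j) y})
     \<le> (\<integral>\<^sup>+x. \<integral>\<^sup>+y. name_dist r x y \<partial>L j \<partial>L j)"
    by metis
  define C where "C = x ` {..<J}"
  define Bad where "Bad = {y \<in> space M. \<forall>x\<in>C. \<theta> \<le> name_dist r x y}"
  have fin: "finite C" and C: "C \<subseteq> space M" and card: "card C \<le> J"
    using x(1) card_image_le[of "{..<J}" x] by (auto simp: C_def)
  have [measurable]: "Bad \<in> sets M"
  proof -
    have "{y \<in> space M. \<theta> \<le> name_dist r x y} \<in> sets M" if "x \<in> C" for x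
      using that C by (auto intro!: measurable_sets borel_measurable_le)
    then show ?thesis unfolding Bad_def using fin by (intro sets.sets_Collect_finite_All) auto
  qed
  have "ennreal h * ?w * (\<theta> * emeasure (slab 0 (real J * h)) Bad)
      = (\<Sum>j<J. ennreal h * ?w * (\<theta> * emeasure (L j) Bad))"
    using nn_integral_slab_partition[of "indicator Bad" h J] h
    by (simp add: L_def sum_distrib_left[symmetric])
  also have "\<dots> \<le> (\<Sum>j<J. \<integral>\<^sup>+x. \<integral>\<^sup>+y. name_dist r x y \<partial>L j \<partial>L j)"
  proof (intro sum_mono order_trans[OF mult_left_mono x(2)] mult_left_mono emeasure_mono)
    fix j assume "j \<in> {..<J}"
    then show "Bad \<subseteq> {y \<in> space M. \<theta> \<le> name_dist r (x j) y}" by (auto simp: Bad_def C_def)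
    have "(\<lambda>y. name_dist r (x j) y) \<in> borel_measurable M" using x(1)[of j] by measurable
    then show "{y \<in> space M. \<theta> \<le> name_dist r (x j) y} \<in> sets (L j)" by (simp add: L_def)
  qed auto
  also have "\<dots> \<le> (\<Sum>j<J. ennreal h * (\<integral>\<^sup>+s. level_spread r s \<partial>window (real j * h) (real (Suc j) * h))
      + ?w * (\<integral>\<^sup>+x. time_spread r h x \<partial>L j))"
    using slab_pairwise_distance[where r=r, of "real j * h" "real (Suc j) * h" for j] h
    by (intro sum_mono) (simp add: L_def algebra_simps)
  also have "\<dots> = ennreal h * (\<integral>\<^sup>+s. level_spread r s \<partial>window 0 (real J * h))
      + ?w * (\<integral>\<^sup>+x. time_spread r h x \<partial>slab 0 (real J * h))"
    using h nn_integral_slab_partition[of "time_spread r h" h J] sum_window_partition[of "level_spread r" h J]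
    by (simp add: sum.distrib sum_distrib_left[symmetric] L_def)
  also have "\<dots> \<le> ennreal h * (?w * D) + ?w * (ennreal (2 * h) * (ennreal r * ennreal \<xi>))"
  proof (intro add_mono mult_left_mono level)
    have "(\<integral>\<^sup>+x. time_spread r h x \<partial>slab 0 (real J * h)) \<le> (\<integral>\<^sup>+x. time_spread r h x \<partial>M)"
      by (intro nn_integral_mono_measure) (auto simp: le_measure slab)
    also have "\<dots> \<le> ennreal (2 * h) * (ennreal r * ennreal \<xi>)"
      using r h \<xi> by (intro nn_integral_time_spread) auto
    finally show "(\<integral>\<^sup>+x. time_spread r h x \<partial>slab 0 (real J * h)) \<le> ennreal (2 * h) * (ennreal r * ennreal \<xi>)" .
  qed auto
  also have "\<dots> = ennreal h * ?w * (D + 2 * (ennreal r * ennreal \<xi>))"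
    using h by (simp add: ennreal_mult algebra_simps)
  finally have "\<theta> * emeasure (slab 0 (real J * h)) Bad \<le> D + 2 * (ennreal r * ennreal \<xi>)"
    using h w W.emeasure_finite[of "space M"]
    by (subst (asm) ennreal_mult_le_mult_iff) (auto simp: ennreal_mult_eq_top_iff)
  then show ?thesis using C fin card unfolding Bad_def by blast
qed

end

section \<open>The base measure of a tower\<close>

lemma (in ergodic_automorphism) iterate_in_space:
  assumes "y \<in> space N" shows "iterate N S n y \<in> space N"
proof -
  have S: "(S ^^ m) y \<in> space N" for m
    using assms auto_bij by (induction m) (auto simp: bij_betw_def)
  have "inv_into (space N) S z \<in> space N" if "z \<in> space N" for z
    using that auto_bij by (auto simp: bij_betw_def intro: inv_into_into)
  then have "(inv_into (space N) S ^^ m) y \<in> space N" for m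
    using assms by (induction m) auto
  with S show ?thesis by (simp add: iterate_def)
qed

text \<open>
  The roof sums increase strictly with their index, so \<open>0\<close> is the only index that qualifies in the
  definition of the flow.
\<close>
lemma (in ergodic_automorphism) special_flow_within_fibre:
  assumes roof: "roof_function N S \<phi>" and y: "y \<in> space N" and st: "0 \<le> s + t" "s + t < \<phi> y"
  shows "special_flow N S \<phi> t (y, s) = (y, s + t)"
proof -
  have pos: "0 < \<phi> (iterate N S j y)" for j
    using roof iterate_in_space[OF y] by (auto simp: roof_function_def)
  have zero: "roof_sum N S \<phi> 0 y = 0" by (simp add: roof_sum_def)
  have one: "roof_sum N S \<phi> 1 y = \<phi> y"
  proof -
    have "{0..<1} = {0::int}" by auto
    then show ?thesis by (simp add: roof_sum_def iterate_def)
  qed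
  have "(THE n. roof_sum N S \<phi> n y \<le> s + t \<and> s + t < roof_sum N S \<phi> (n + 1) y) = 0"
  proof (rule the_equality)
    fix n assume n: "roof_sum N S \<phi> n y \<le> s + t \<and> s + t < roof_sum N S \<phi> (n + 1) y"
    show "n = 0"
    proof (rule ccontr)
      assume "n \<noteq> 0"
      then consider "1 \<le> n" | "n \<le> - 1" by linarith
      then show False
      proof cases
        case 1
        have "\<phi> (iterate N S 0 y) \<le> (\<Sum>j\<in>{0..<n}. \<phi> (iterate N S j y))"
          using 1 pos by (intro member_le_sum) (auto intro: order.strict_implies_order)
        then show False using 1 n st by (simp add: roof_sum_def iterate_def)
      next
        case 2
        have "0 \<le> (\<Sum>j\<in>{n+1..<0}. \<phi> (iterate N S j y))"
          using pos by (intro sum_nonneg) (auto intro: order.strict_implies_order)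
        then have "roof_sum N S \<phi> (n + 1) y \<le> 0"
          using 2 by (auto simp: roof_sum_def)
        then show False using n st by simp
      qed
    qed
  qed (use zero one st in auto)
  then show ?thesis by (simp add: special_flow_def zero iterate_def)
qed

context measure_preserving_flow
begin

lemma flow_inverse: "x \<in> space M \<Longrightarrow> T (- t) (T t x) = x"
  using flow_add[of x "- t" t] by (simp add: flow_zero)

lemma flow_image_eq:
  assumes "A \<subseteq> space M"
  shows "T t ` A = {x \<in> space M. T (- t) x \<in> A}"
proof -
  have "x \<in> T t ` A" if "x \<in> space M" "T (- t) x \<in> A" for x
    using that flow_inverse[of x "- t"] by (intro image_eqI[of _ _ "T (- t) x"]) auto
  then show ?thesis using assms by (auto simp: flow_inverse subset_iff)
qed

text \<open>
  \<open>W\<close> is the restriction of the base measure to the copy of \<open>B\<close>, multiplied by the normalising factor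
  \<open>\<kappa>\<close> of the special measure.  Above \<open>B\<close> the special flow moves vertically up to height \<open>H\<close>, and there
  the special measure is \<open>\<kappa>\<close> times the product of the base measure and Lebesgue measure; the
  isomorphism carries this over to the phase space.  The last clause allows monochromatic levels to be
  expressed by \<open>W\<close>, since the factor \<open>\<kappa>\<close> does not affect proportions.
\<close>
lemma tower_base_measure:
  fixes N :: "'b measure"
  assumes rep: "special_representation M T H \<eta> N S \<phi> B Z\<^sub>0 \<psi>" and H: "0 < H"
  defines "B' \<equiv> base_copy B Z\<^sub>0 \<psi>" and "\<nu> \<equiv> base_measure M N Z\<^sub>0 \<psi>"
  shows "\<exists>W \<kappa>. finite_measure W \<and> sets W = sets M \<and> 0 < \<kappa> \<and> B' \<subseteq> space M \<and>
     (\<forall>A\<in>sets M. (\<integral>\<^sup>+s\<in>{0..<H}. emeasure W {y \<in> space M. T s y \<in> A} \<partial>lborel) \<le> emeasure M A) \<and>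
     emeasure M (tower T H B') \<le> ennreal H * emeasure W (space M) \<and>
     (\<forall>s. \<forall>A\<in>sets M. measure W {y \<in> space M. T s y \<in> A}
        = \<kappa> * measure (distr \<nu> M (T s)) (T s ` B' \<inter> A))"
proof -
  define Z where "Z = special_measure N \<phi>"
  define U where "U = special_flow N S \<phi>"
  interpret A: ergodic_automorphism N S using rep by (simp add: special_representation_def)
  have roof: "roof_function N S \<phi>" and "flow_isomorphism Z U M T Z\<^sub>0 \<psi>"
    and B[measurable]: "B \<in> sets N" and \<phi>B: "\<And>y. y \<in> B \<Longrightarrow> \<phi> y = H"
    using rep by (auto simp: special_representation_def Z_def U_def)
  then have Z0: "Z\<^sub>0 \<in> sets Z" and inv: "\<And>t. U t ` Z\<^sub>0 = Z\<^sub>0" and img: "\<psi> ` Z\<^sub>0 \<in> sets M" and inj: "inj_on \<psi> Z\<^sub>0"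
    and \<psi>: "\<psi> \<in> restrict_space Z Z\<^sub>0 \<rightarrow>\<^sub>M restrict_space M (\<psi> ` Z\<^sub>0)"
    and \<psi>': "inv_into Z\<^sub>0 \<psi> \<in> restrict_space M (\<psi> ` Z\<^sub>0) \<rightarrow>\<^sub>M restrict_space Z Z\<^sub>0"
    and dist: "distr (restrict_space Z Z\<^sub>0) (restrict_space M (\<psi> ` Z\<^sub>0)) \<psi> = restrict_space M (\<psi> ` Z\<^sub>0)"
    and equi: "\<And>t z. z \<in> Z\<^sub>0 \<Longrightarrow> \<psi> (U t z) = T t (\<psi> z)"
    by (auto simp: flow_isomorphism_def)
  have \<phi>[measurable]: "\<phi> \<in> borel_measurable N" and \<phi>int: "integrable N \<phi>" and \<phi>pos: "\<And>y. y \<in> space N \<Longrightarrow> 0 < \<phi> y"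
    using roof by (auto simp: roof_function_def)
  define c where "c = 1 / (\<integral>\<^sup>+ y. ennreal (\<phi> y) \<partial>N)"
  have "(\<integral>\<^sup>+ y. ennreal (\<phi> y) \<partial>N) \<noteq> \<infinity>"
    using \<phi>int by (simp add: nn_integral_eq_integral \<phi>pos less_imp_le)
  moreover have "(\<integral>\<^sup>+ y. ennreal (\<phi> y) \<partial>N) \<noteq> 0"
  proof
    assume "(\<integral>\<^sup>+ y. ennreal (\<phi> y) \<partial>N) = 0"
    then have "AE y in N. ennreal (\<phi> y) = 0" by (subst (asm) nn_integral_0_iff_AE) auto
    then have "AE y in N. False" by (rule AE_mp) (use \<phi>pos in \<open>auto intro!: AE_I2 simp: ennreal_eq_0_iff not_le\<close>)
    then show False by simp
  qed
  ultimately have c: "c \<noteq> 0" "c \<noteq> \<infinity>"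
    by (auto simp: c_def ennreal_divide_eq_top_iff ennreal_divide_eq_0_iff)
  interpret NL: pair_sigma_finite N lborel
    by (simp add: pair_sigma_finite_def A.sigma_finite_measure_axioms lborel.sigma_finite_measure_axioms)
  let ?P = "N \<Otimes>\<^sub>M lborel"
  have "special_space N \<phi> = {z \<in> space ?P. 0 \<le> snd z \<and> snd z < \<phi> (fst z)}"
    by (auto simp: special_space_def space_pair_measure)
  moreover have "{z \<in> space ?P. 0 \<le> snd z \<and> snd z < \<phi> (fst z)} \<in> sets ?P" by measurable
  ultimately have SS: "special_space N \<phi> \<in> sets ?P" by (simp only:)
  have setsZ: "A \<in> sets Z \<longleftrightarrow> A \<in> sets ?P \<and> A \<subseteq> special_space N \<phi>" for A
    unfolding Z_def special_measure_def using SS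
    by (auto simp: sets_restrict_space_iff)
  have emZ: "emeasure Z A = c * emeasure ?P A" if "A \<in> sets Z" for A
    using that SS sets.sets_into_space[of A Z] setsZ[of A] unfolding Z_def special_measure_def c_def
    by (simp add: emeasure_restrict_space)
  have Z0P[measurable]: "Z\<^sub>0 \<in> sets ?P" and Z0s: "Z\<^sub>0 \<subseteq> special_space N \<phi>"
    using Z0 setsZ by auto
  have spZ0: "Z\<^sub>0 \<inter> space Z \<in> sets Z" using Z0 by auto
  have setsZ0: "A \<in> sets (restrict_space Z Z\<^sub>0) \<longleftrightarrow> A \<in> sets Z \<and> A \<subseteq> Z\<^sub>0" for A
    using sets_restrict_space_iff[OF spZ0] by auto
  have imgs: "\<psi> ` Z\<^sub>0 \<subseteq> space M" using img by (rule sets.sets_into_space)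
  have sp_rM: "space (restrict_space M (\<psi> ` Z\<^sub>0)) = \<psi> ` Z\<^sub>0"
    using imgs by (auto simp: space_restrict_space)
  have sp_rZ: "space (restrict_space Z Z\<^sub>0) = Z\<^sub>0"
    using sets.sets_into_space[OF Z0] by (auto simp: space_restrict_space)
  have image_meas: "\<psi> ` D \<in> sets M" and image_em: "emeasure M (\<psi> ` D) = emeasure Z D"
    if D: "D \<in> sets Z" "D \<subseteq> Z\<^sub>0" for D
  proof -
    have "\<psi> ` D = inv_into Z\<^sub>0 \<psi> -` D \<inter> space (restrict_space M (\<psi> ` Z\<^sub>0))"
      unfolding sp_rM using D(2) inj by (auto simp: inv_into_f_f subset_iff)
    also have "\<dots> \<in> sets (restrict_space M (\<psi> ` Z\<^sub>0))"
      using D setsZ0 by (intro measurable_sets[OF \<psi>']) auto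
    finally have m: "\<psi> ` D \<in> sets (restrict_space M (\<psi> ` Z\<^sub>0))" .
    then show "\<psi> ` D \<in> sets M" using img imgs by (simp add: sets_restrict_space_iff Int_absorb2)
    have "emeasure M (\<psi> ` D) = emeasure (restrict_space M (\<psi> ` Z\<^sub>0)) (\<psi> ` D)"
      using D(2) img imgs by (intro emeasure_restrict_space[symmetric]) (auto simp: Int_absorb2)
    also have "\<dots> = emeasure (restrict_space Z Z\<^sub>0) (\<psi> -` (\<psi> ` D) \<inter> space (restrict_space Z Z\<^sub>0))"
      by (subst dist[symmetric], rule emeasure_distr[OF \<psi> m])
    also have "\<psi> -` (\<psi> ` D) \<inter> space (restrict_space Z Z\<^sub>0) = D"
      unfolding sp_rZ using D(2) inj by (auto simp: inj_on_def)
    also have "emeasure (restrict_space Z Z\<^sub>0) D = emeasure Z D"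
      using D spZ0 by (intro emeasure_restrict_space) auto
    finally show "emeasure M (\<psi> ` D) = emeasure Z D" .
  qed
  have \<psi>M: "\<psi> \<in> restrict_space Z Z\<^sub>0 \<rightarrow>\<^sub>M M"
    using \<psi> by (auto simp: measurable_restrict_space2_iff)
  define Y where "Y = {y \<in> space N. (y, 0) \<in> Z\<^sub>0}"
  have Y[measurable]: "Y \<in> sets N" unfolding Y_def by measurable
  have Ysp: "{y. (y, 0) \<in> Z\<^sub>0} = Y"
    using Z0s by (auto simp: Y_def special_space_def)
  define f where "f y = \<psi> (y, 0)" for y
  have f: "f \<in> restrict_space N Y \<rightarrow>\<^sub>M M"
  proof -
    have "(\<lambda>y. (y, 0)) \<in> restrict_space N Y \<rightarrow>\<^sub>M restrict_space Z Z\<^sub>0"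
    proof (rule measurableI)
      fix A assume "A \<in> sets (restrict_space Z Z\<^sub>0)"
      then have A: "A \<in> sets ?P" "A \<subseteq> Z\<^sub>0" using setsZ0 setsZ by auto
      then have "(\<lambda>y. (y, 0)) -` A \<inter> space N \<in> sets N"
        by (intro measurable_sets[of _ N ?P]) auto
      moreover have "(\<lambda>y. (y, 0)) -` A \<inter> space N \<subseteq> Y" using A by (auto simp: Y_def)
      moreover have "(\<lambda>y. (y, 0)) -` A \<inter> space (restrict_space N Y) = (\<lambda>y. (y, 0)) -` A \<inter> space N"
        using A by (auto simp: space_restrict_space Y_def)
      ultimately show "(\<lambda>y. (y, 0)) -` A \<inter> space (restrict_space N Y) \<in> sets (restrict_space N Y)"
        by (auto simp: sets_restrict_space_iff)
    qed (use sets.sets_into_space[OF Z0] in \<open>auto simp: space_restrict_space Y_def\<close>)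
    from measurable_compose[OF this \<psi>M] show ?thesis unfolding f_def .
  qed
  define B0 where "B0 = B \<inter> Y"
  have B0[measurable]: "B0 \<in> sets N" by (simp add: B0_def)
  have fY: "f y \<in> space M" if "y \<in> Y" for y
    using that imgs by (auto simp: f_def Y_def)
  have B': "B' = f ` B0"
    using sets.sets_into_space[OF B] by (auto simp: B'_def base_copy_def B0_def Y_def f_def)
  have \<nu>: "\<nu> = distr (restrict_space N Y) M f"
    unfolding \<nu>_def base_measure_def Ysp f_def ..
  have em\<nu>: "emeasure \<nu> A = emeasure N {y \<in> Y. f y \<in> A}" if "A \<in> sets M" for A
  proof -
    have "emeasure \<nu> A = emeasure (restrict_space N Y) (f -` A \<inter> space (restrict_space N Y))"
      unfolding \<nu> by (rule emeasure_distr[OF f that])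
    also have "f -` A \<inter> space (restrict_space N Y) = {y \<in> Y. f y \<in> A}"
      using sets.sets_into_space[OF Y] by (auto simp: space_restrict_space)
    also have "emeasure (restrict_space N Y) \<dots> = emeasure N \<dots>"
      by (intro emeasure_restrict_space) auto
    finally show ?thesis .
  qed
  \<comment> \<open>Above \<open>B\<close> the flow moves vertically, hence \<open>T\<^sub>s\<close> maps the copy of \<open>B\<close> to the image of a
    level of the special space; invariance of \<open>Z\<^sub>0\<close> keeps that level inside it.\<close>
  have vert: "U s (y, 0) = (y, s)" and vertZ: "(y, s) \<in> Z\<^sub>0" and vert\<psi>: "T s (f y) = \<psi> (y, s)"
    if "y \<in> B0" "0 \<le> s" "s < H" for y s
  proof -
    have yz: "y \<in> space N" "(y, 0) \<in> Z\<^sub>0" using that by (auto simp: B0_def Y_def)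
    then show U: "U s (y, 0) = (y, s)"
      unfolding U_def using that \<phi>B by (subst A.special_flow_within_fibre[OF roof]) (auto simp: B0_def)
    then show "(y, s) \<in> Z\<^sub>0" using inv[of s] yz by force
    show "T s (f y) = \<psi> (y, s)" using equi[OF yz(2), of s] U by (simp add: f_def)
  qed
  define D where "D = B0 \<times> {0..<H}"
  have DP: "D \<in> sets ?P" unfolding D_def by (intro pair_measureI) auto
  have DZ0: "D \<subseteq> Z\<^sub>0" using vertZ by (auto simp: D_def)
  then have DZ: "D \<in> sets Z" using DP Z0s setsZ by auto
  have tower: "tower T H B' = \<psi> ` D"
    by (force simp: tower_def B' D_def vert\<psi>)
  have "B0 \<times> {0} \<subseteq> D" using H by (auto simp: D_def)
  then have "B0 \<times> {0} \<in> sets Z" "B0 \<times> {0} \<subseteq> Z\<^sub>0"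
    using setsZ[of "B0 \<times> {0}"] Z0s DZ0 by (auto intro!: pair_measureI)
  moreover have "\<psi> ` (B0 \<times> {0}) = B'" by (auto simp: B' f_def)
  ultimately have B'm[measurable]: "B' \<in> sets M" using image_meas by metis
  have B's: "B' \<subseteq> space M" using B'm by (rule sets.sets_into_space)
  define W where "W = scale_measure c (density \<nu> (indicator B'))"
  have sets\<nu>[measurable_cong]: "sets \<nu> = sets M" by (simp add: \<nu>)
  have setsW: "sets W = sets M" by (simp add: W_def sets\<nu>)
  have W\<nu>: "emeasure W A = c * emeasure \<nu> (B' \<inter> A)" if "A \<in> sets M" for A
    using that by (simp add: W_def emeasure_density sets\<nu> nn_integral_indicator flip: indicator_inter_arith)
  have WN: "emeasure W A = c * emeasure N {y \<in> B0. f y \<in> A}" if "A \<in> sets M" for A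
  proof -
    have "f y \<in> B' \<longleftrightarrow> y \<in> B0" if "y \<in> Y" for y
      using that inj unfolding B' by (auto simp: f_def inj_on_def B0_def Y_def)
    then have "{y \<in> Y. f y \<in> B' \<inter> A} = {y \<in> B0. f y \<in> A}" by (auto simp: B0_def)
    then show ?thesis using W\<nu>[OF that] em\<nu>[of "B' \<inter> A"] that by simp
  qed
  have spW: "space W = space M" using setsW by (rule sets_eq_imp_space_eq)
  have Wspace: "emeasure W (space M) = c * emeasure N B0"
  proof -
    have "{y \<in> B0. f y \<in> space M} = B0" using fY by (auto simp: B0_def)
    then show ?thesis by (simp add: WN)
  qed
  have Tm[measurable]: "{y \<in> space M. T s y \<in> A} \<in> sets M" if [measurable]: "A \<in> sets M" for s A
    by measurable
  have finW: "finite_measure W"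
    using c A.emeasure_finite[of B0]
    by (intro finite_measureI) (auto simp: spW Wspace ennreal_mult_eq_top_iff)
  have emP: "emeasure ?P X = (\<integral>\<^sup>+s. emeasure N ((\<lambda>y. (y, s)) -` X) \<partial>lborel)" if "X \<in> sets ?P" for X
    using that by (rule NL.emeasure_pair_measure_alt2)
  have le: "(\<integral>\<^sup>+s\<in>{0..<H}. emeasure W {y \<in> space M. T s y \<in> A} \<partial>lborel) \<le> emeasure M A"
    if A[measurable]: "A \<in> sets M" for A
  proof -
    define X where "X = {z \<in> D. \<psi> z \<in> A}"
    have "X = (\<psi> -` A \<inter> space (restrict_space Z Z\<^sub>0)) \<inter> D"
      using DZ0 by (auto simp: X_def sp_rZ)
    moreover have "\<psi> -` A \<inter> space (restrict_space Z Z\<^sub>0) \<in> sets Z"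
      using measurable_sets[OF \<psi>M A] setsZ0 by auto
    ultimately have XZ: "X \<in> sets Z" using DZ by auto
    have XZ0: "X \<subseteq> Z\<^sub>0" using DZ0 by (auto simp: X_def)
    have XP: "X \<in> sets ?P" using XZ setsZ by auto
    have eq: "emeasure W {y \<in> space M. T s y \<in> A} * indicator {0..<H} s
        = c * emeasure N ((\<lambda>y. (y, s)) -` X)" for s
    proof (cases "s \<in> {0..<H}")
      case True
      have "{y \<in> B0. f y \<in> {y \<in> space M. T s y \<in> A}} = (\<lambda>y. (y, s)) -` X"
        using True fY by (auto simp: X_def D_def vert\<psi> B0_def)
      then show ?thesis using True by (simp add: WN)
    next
      case False
      then have "(\<lambda>y. (y, s)) -` X = {}" by (auto simp: X_def D_def)
      then show ?thesis using False by simp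
    qed
    have "(\<integral>\<^sup>+s\<in>{0..<H}. emeasure W {y \<in> space M. T s y \<in> A} \<partial>lborel)
        = c * (\<integral>\<^sup>+s. emeasure N ((\<lambda>y. (y, s)) -` X) \<partial>lborel)"
      unfolding eq using NL.measurable_emeasure_Pair2[OF XP] by (intro nn_integral_cmult) simp
    also have "\<dots> = emeasure Z X" by (simp add: emP[OF XP] emZ[OF XZ])
    also have "\<dots> = emeasure M (\<psi> ` X)" using image_em[OF XZ XZ0] by simp
    also have "\<dots> \<le> emeasure M A" by (intro emeasure_mono A) (auto simp: X_def)
    finally show ?thesis .
  qed
  have "emeasure M (tower T H B') = emeasure Z D"
    unfolding tower by (rule image_em[OF DZ DZ0])
  also have "\<dots> = c * (emeasure N B0 * ennreal H)"
    unfolding emZ[OF DZ] unfolding D_def using H by (subst lborel.emeasure_pair_measure_Times) auto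
  finally have tow: "emeasure M (tower T H B') \<le> ennreal H * emeasure W (space M)"
    by (simp add: Wspace mult_ac)
  have ratio: "measure W {y \<in> space M. T s y \<in> A} = enn2real c * measure (distr \<nu> M (T s)) (T s ` B' \<inter> A)"
    if A[measurable]: "A \<in> sets M" for s A
  proof -
    have im: "T s ` B' = {x \<in> space M. T (- s) x \<in> B'}" by (rule flow_image_eq[OF B's])
    have TB[measurable]: "T s ` B' \<in> sets M" unfolding im by measurable
    have "space \<nu> = space M" using sets\<nu> by (rule sets_eq_imp_space_eq)
    then have "T s -` (T s ` B' \<inter> A) \<inter> space \<nu> = B' \<inter> {y \<in> space M. T s y \<in> A}"
      unfolding im using B's by (auto simp: flow_inverse)
    moreover have "emeasure (distr \<nu> M (T s)) (T s ` B' \<inter> A) = emeasure \<nu> (T s -` (T s ` B' \<inter> A) \<inter> space \<nu>)"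
      by (rule emeasure_distr) measurable
    ultimately have "emeasure W {y \<in> space M. T s y \<in> A} = c * emeasure (distr \<nu> M (T s)) (T s ` B' \<inter> A)"
      by (simp add: W\<nu>)
    then show ?thesis by (simp add: measure_def enn2real_mult)
  qed
  have "0 < enn2real c" using c by (simp add: enn2real_positive_iff less_top zero_less_iff_neq_zero)
  then show ?thesis
    using finW setsW B's le tow ratio by (intro exI[of _ W] exI[of _ "enn2real c"]) auto
qed

end

section \<open>A tower with nearly constant levels\<close>

lemma fibre_partition:
  assumes \<theta>[measurable]: "\<theta> \<in> M \<rightarrow>\<^sub>M count_space UNIV" and fin: "finite (\<theta> ` space M)"
  shows "\<exists>k Q. finite_measurable_partition M k Q \<and> (\<forall>i\<in>{1..k}. \<forall>x\<in>Q i. \<forall>y\<in>Q i. \<theta> x = \<theta> y)"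
proof -
  obtain e where e: "bij_betw e {1..card (\<theta> ` space M)} (\<theta> ` space M)"
    using ex_bij_betw_nat_finite_1[OF fin] by blast
  define k where "k = card (\<theta> ` space M)"
  define Q where "Q i = \<theta> -` {e i} \<inter> space M" for i
  have ne: "Q i \<noteq> {}" if "i \<in> {1..k}" for i
    using bij_betwE[OF e] that by (force simp: Q_def k_def)
  have disj: "Q i \<inter> Q j = {}" if "i \<in> {1..k}" "j \<in> {1..k}" "i \<noteq> j" for i j
  proof -
    have "e i \<noteq> e j" using inj_onD[OF bij_betw_imp_inj_on[OF e], of i j] that by (auto simp: k_def)
    then show ?thesis by (auto simp: Q_def)
  qed
  have "\<Union> (Q ` {1..k}) = space M"
    using e by (auto simp: Q_def k_def bij_betw_def) (metis image_iff image_eqI)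
  moreover have "inj_on Q {1..k}"
    using ne disj by (metis (no_types, lifting) inj_onI Int_absorb)
  moreover have "Q ` {1..k} \<subseteq> sets M" by (auto simp: Q_def)
  moreover have "disjoint (Q ` {1..k})"
  proof (rule disjointI)
    fix X Y assume "X \<in> Q ` {1..k}" "Y \<in> Q ` {1..k}" "X \<noteq> Y"
    then obtain i j where "X = Q i" "Y = Q j" "i \<in> {1..k}" "j \<in> {1..k}" "i \<noteq> j" by blast
    then show "X \<inter> Y = {}" using disj by simp
  qed
  moreover have "{} \<notin> Q ` {1..k}" using ne by blast
  ultimately have "finite_measurable_partition M k Q"
    by (simp add: finite_measurable_partition_def partition_on_def)
  then show ?thesis by (intro exI[of _ k] exI[of _ Q]) (auto simp: Q_def)
qed

text \<open>
  Two points with different values cannot both lie in \<open>A\<close>.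
\<close>
lemma (in finite_measure) mean_fibre_disagreement:
  fixes \<theta> :: "'a \<Rightarrow> 'b"
  assumes A[measurable]: "A \<in> sets M" and const: "\<And>x y. x \<in> A \<Longrightarrow> y \<in> A \<Longrightarrow> \<theta> x = \<theta> y"
    and large: "(1 - \<delta>) * measure M (space M) \<le> measure M A"
  shows "(\<integral>\<^sup>+x. \<integral>\<^sup>+y. of_bool (\<theta> x \<noteq> \<theta> y) \<partial>M \<partial>M) \<le> ennreal (2 * \<delta> * (measure M (space M))\<^sup>2)"
proof -
  let ?w = "measure M (space M)"
  define b where "b = measure M (space M - A)"
  have b: "b \<le> \<delta> * ?w" unfolding b_def using large by (subst finite_measure_compl) (auto simp: algebra_simps)
  have "(\<integral>\<^sup>+x. \<integral>\<^sup>+y. of_bool (\<theta> x \<noteq> \<theta> y) \<partial>M \<partial>M)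
      \<le> (\<integral>\<^sup>+x. \<integral>\<^sup>+y. indicator (space M - A) x + indicator (space M - A) y \<partial>M \<partial>M)"
  proof (rule nn_integral_mono, rule nn_integral_mono)
    fix x y assume "x \<in> space M" "y \<in> space M"
    then show "of_bool (\<theta> x \<noteq> \<theta> y) \<le> (indicator (space M - A) x + indicator (space M - A) y :: ennreal)"
      using const[of x y] by (cases "x \<in> A"; cases "y \<in> A") (simp_all add: of_bool_def)
  qed
  also have "\<dots> = (\<integral>\<^sup>+x. ennreal ?w * indicator (space M - A) x + ennreal b \<partial>M)"
    by (intro nn_integral_cong) (auto simp: nn_integral_add emeasure_eq_measure b_def mult.commute)
  also have "\<dots> = ennreal ?w * ennreal b + ennreal b * ennreal ?w"
    by (subst nn_integral_add) (auto simp: nn_integral_cmult emeasure_eq_measure b_def)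
  also have "\<dots> = ennreal (2 * (b * ?w))"
    by (simp add: b_def flip: ennreal_mult ennreal_plus)
  also have "\<dots> \<le> ennreal (2 * \<delta> * ?w\<^sup>2)"
    using mult_right_mono[OF b, of ?w] by (intro ennreal_leI) (auto simp: power2_eq_square mult_ac)
  finally show ?thesis .
qed

text \<open>
  The tower is chosen monochromatic for the partition into fibres of \<open>\<theta>\<close>.  Two random points of a
  monochromatic level have different values with probability at most \<open>2\<delta>\<close>, and the other levels make
  up a proportion of at most \<open>\<delta>\<close>; this explains the factor \<open>3\<delta>\<close>.
\<close>
lemma rank_one_tower:
  fixes \<theta> :: "'a \<Rightarrow> 'b"
  assumes rank: "beta_rank_one_flow M T \<beta>" and \<delta>: "0 < \<delta>" "\<delta> < 1"
    and \<theta>[measurable]: "\<theta> \<in> M \<rightarrow>\<^sub>M count_space UNIV" and fin: "finite (\<theta> ` space M)"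
  shows "\<exists>H W. 0 < H \<and> finite_measure W \<and> sets W = sets M \<and> \<beta> - \<delta> < H * measure W (space M) \<and>
     (\<forall>A\<in>sets M. (\<integral>\<^sup>+s\<in>{0..<H}. emeasure W {y \<in> space M. T s y \<in> A} \<partial>lborel) \<le> emeasure M A) \<and>
     (\<integral>\<^sup>+s. \<integral>\<^sup>+x. \<integral>\<^sup>+y. of_bool (\<theta> (T s x) \<noteq> \<theta> (T s y)) \<partial>W \<partial>W \<partial>window 0 H)
       \<le> ennreal (3 * \<delta> * H * (measure W (space M))\<^sup>2)"
proof -
  interpret ergodic_flow M T using rank by (simp add: beta_rank_one_flow_def)
  obtain k Q where Q: "finite_measurable_partition M k Q"
    and const: "\<And>i x y. i \<in> {1..k} \<Longrightarrow> x \<in> Q i \<Longrightarrow> y \<in> Q i \<Longrightarrow> \<theta> x = \<theta> y"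
    using fibre_partition[OF \<theta> fin] by blast
  obtain H \<eta> and N :: "'a measure" and S \<phi> B Z\<^sub>0 \<psi> where H: "0 < H"
    and rep: "special_representation M T H \<eta> N S \<phi> B Z\<^sub>0 \<psi>"
    and tower: "\<beta> - \<delta> < measure M (tower T H (base_copy B Z\<^sub>0 \<psi>))"
    and mono: "monochromatic_tower M T (base_measure M N Z\<^sub>0 \<psi>) H (base_copy B Z\<^sub>0 \<psi>) k Q \<delta>"
    using rank[unfolded beta_rank_one_flow_def, THEN conjunct2, rule_format, OF \<delta>(1) Q] by blast
  let ?d = "\<lambda>s. distr (base_measure M N Z\<^sub>0 \<psi>) M (T s)" and ?B = "base_copy B Z\<^sub>0 \<psi>"
  obtain W \<kappa> where W: "finite_measure W" "sets W = sets M" and \<kappa>: "0 < \<kappa>" and Bs: "?B \<subseteq> space M"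
    and slab: "\<forall>A\<in>sets M. (\<integral>\<^sup>+s\<in>{0..<H}. emeasure W {y \<in> space M. T s y \<in> A} \<partial>lborel) \<le> emeasure M A"
    and mass: "emeasure M (tower T H ?B) \<le> ennreal H * emeasure W (space M)"
    and ratio: "\<And>s A. A \<in> sets M \<Longrightarrow> measure W {y \<in> space M. T s y \<in> A} = \<kappa> * measure (?d s) (T s ` ?B \<inter> A)"
    using tower_base_measure[OF rep H] by blast
  interpret W: finite_measure W by fact
  have spW: "space W = space M" using W(2) by (rule sets_eq_imp_space_eq)
  note W(2)[measurable_cong]
  define w where "w = measure W (space M)"
  have w0: "0 \<le> w" by (simp add: w_def)
  have emW: "emeasure W (space M) = ennreal w" by (simp add: w_def W.emeasure_eq_measure)
  have Qm[measurable]: "Q i \<in> sets M" if "i \<in> {1..k}" for i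
    using Q that by (auto simp: finite_measurable_partition_def)
  define L where "L i s = {y \<in> space M. T s y \<in> Q i}" for i s
  have L[measurable]: "L i s \<in> sets M" if "i \<in> {1..k}" for i s
    using that unfolding L_def by measurable
  have level: "monochromatic_level M T (base_measure M N Z\<^sub>0 \<psi>) ?B k Q \<delta> s
      \<longleftrightarrow> (\<exists>i\<in>{1..k}. (1 - \<delta>) * w \<le> measure W (L i s))" for s
  proof -
    have "T s ` ?B \<inter> space M = T s ` ?B" using Bs by auto
    then have "w = \<kappa> * measure (?d s) (T s ` ?B)"
      using ratio[of "space M" s] by (simp add: w_def cong: conj_cong)
    then have "(1 - \<delta>) * w \<le> measure W (L i s)
        \<longleftrightarrow> (1 - \<delta>) * measure (?d s) (T s ` ?B) \<le> measure (?d s) (T s ` ?B \<inter> Q i)" if "i \<in> {1..k}" for i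
      using \<kappa> ratio[OF Qm[OF that], of s] by (simp add: L_def mult.left_commute)
    then show ?thesis by (auto simp: monochromatic_level_def)
  qed
  define Mono where "Mono = {s \<in> {0..<H}. \<exists>i\<in>{1..k}. (1 - \<delta>) * w \<le> measure W (L i s)}"
  have "Mono \<in> sets borel"
  proof -
    have "(\<lambda>s. measure W (L i s)) \<in> borel_measurable borel" if i[measurable]: "i \<in> {1..k}" for i
    proof -
      have [measurable]: "Q i \<in> sets M" using i by simp
      have "{z \<in> space (borel \<Otimes>\<^sub>M W). T (fst z) (snd z) \<in> Q i} \<in> sets (borel \<Otimes>\<^sub>M W)"
        by measurable
      then have "(\<lambda>s. emeasure W (L i s)) \<in> borel_measurable borel"
        by (intro W.measurable_emeasure) (auto simp: L_def spW space_pair_measure cong: conj_cong)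
      then show ?thesis unfolding measure_def by measurable
    qed
    then have "{s \<in> space borel. (1 - \<delta>) * w \<le> measure W (L i s)} \<in> sets borel" if "i \<in> {1..k}" for i
      using that by (intro borel_measurable_le borel_measurable_const)
    then have "{0..<H} \<inter> (\<Union>i\<in>{1..k}. {s \<in> space borel. (1 - \<delta>) * w \<le> measure W (L i s)}) \<in> sets borel"
      by (intro sets.Int sets.finite_UN) simp_all
    also have "{0..<H} \<inter> (\<Union>i\<in>{1..k}. {s \<in> space borel. (1 - \<delta>) * w \<le> measure W (L i s)}) = Mono"
      by (auto simp: Mono_def)
    finally show ?thesis .
  qed
  note this[measurable]
  have Mono_large: "(1 - \<delta>) * H \<le> measure lborel Mono"
    using mono unfolding monochromatic_tower_def level Mono_def .
  have "emeasure lborel ({0..<H} - Mono) \<le> ennreal (\<delta> * H)"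
  proof -
    have MH: "Mono \<subseteq> {0..<H}" by (auto simp: Mono_def)
    have "emeasure lborel Mono \<le> emeasure lborel {0..<H}" using MH by (intro emeasure_mono) auto
    also have "\<dots> < \<infinity>" using H by simp
    finally have fin: "emeasure lborel Mono \<noteq> top" by simp
    note M = emeasure_eq_ennreal_measure[OF fin] fin
    have "emeasure lborel ({0..<H} - Mono) = ennreal H - ennreal (measure lborel Mono)"
      using M MH H by (subst emeasure_Diff) auto
    also have "\<dots> \<le> ennreal (\<delta> * H)"
      using Mono_large by (subst ennreal_minus) (auto intro!: ennreal_leI simp: algebra_simps)
    finally show ?thesis .
  qed
  note bad = this
  define p where "p s = (\<integral>\<^sup>+x. \<integral>\<^sup>+y. of_bool (\<theta> (T s x) \<noteq> \<theta> (T s y)) \<partial>W \<partial>W)" for s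
  have p: "p s \<le> ennreal (2 * \<delta> * w\<^sup>2) + ennreal (w\<^sup>2) * indicator ({0..<H} - Mono) s" if s: "s \<in> {0..<H}" for s
  proof (cases "s \<in> Mono")
    case True
    then obtain i where i: "i \<in> {1..k}" "(1 - \<delta>) * w \<le> measure W (L i s)" by (auto simp: Mono_def)
    then have "p s \<le> ennreal (2 * \<delta> * w\<^sup>2)"
      unfolding p_def w_def spW[symmetric]
      by (intro W.mean_fibre_disagreement[of "L i s" "\<lambda>x. \<theta> (T s x)"] const[of i])
        (auto simp: L_def W(2) spW w_def intro: L[unfolded L_def])
    then show ?thesis by (rule order_trans) simp
  next
    case False
    have "p s \<le> (\<integral>\<^sup>+x. \<integral>\<^sup>+y. 1 \<partial>W \<partial>W)"
      unfolding p_def by (intro nn_integral_mono) simp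
    also have "\<dots> = ennreal (w\<^sup>2)"
      using w0 by (simp add: emW spW power2_eq_square ennreal_mult)
    finally show ?thesis using False s by (simp add: add_increasing)
  qed
  have "(\<integral>\<^sup>+s. p s \<partial>window 0 H)
      \<le> (\<integral>\<^sup>+s. ennreal (2 * \<delta> * w\<^sup>2) + ennreal (w\<^sup>2) * indicator ({0..<H} - Mono) s \<partial>window 0 H)"
    by (rule nn_integral_mono_AE, rule AE_mp[OF AE_window], intro AE_I2 impI p) simp
  also have "\<dots> = ennreal (2 * \<delta> * w\<^sup>2) * ennreal H + ennreal (w\<^sup>2) * emeasure (window 0 H) ({0..<H} - Mono)"
    using H by (subst nn_integral_add) (auto simp: nn_integral_cmult)
  also have "emeasure (window 0 H) ({0..<H} - Mono) = emeasure lborel ({0..<H} - Mono)"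
    by (subst emeasure_window) (auto intro!: arg_cong[where f="emeasure lborel"])
  also have "ennreal (2 * \<delta> * w\<^sup>2) * ennreal H + ennreal (w\<^sup>2) * emeasure lborel ({0..<H} - Mono)
      \<le> ennreal (2 * \<delta> * w\<^sup>2) * ennreal H + ennreal (w\<^sup>2) * ennreal (\<delta> * H)"
    by (intro add_left_mono mult_left_mono bad) auto
  also have "\<dots> = ennreal (3 * \<delta> * H * w\<^sup>2)"
    using \<delta> H w0 by (simp flip: ennreal_mult ennreal_plus add: algebra_simps)
  finally have spread: "(\<integral>\<^sup>+s. p s \<partial>window 0 H) \<le> ennreal (3 * \<delta> * H * w\<^sup>2)" .
  have "measure M (tower T H ?B) \<le> H * w"
    using mass H w0 unfolding emW by (simp add: emeasure_eq_measure ennreal_mult[symmetric])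
  with tower have "\<beta> - \<delta> < H * w" by linarith
  then show ?thesis using H W slab spread unfolding p_def w_def by blast
qed

section \<open>From name distances to the covering number\<close>

text \<open>
  The label that \<open>orbit_name\<close> records, as a function of the point.
\<close>
definition atom_index :: "nat \<Rightarrow> (nat \<Rightarrow> 'a set) \<Rightarrow> 'a \<Rightarrow> nat" where
  "atom_index k P x = (THE i. i \<in> {1..k} \<and> x \<in> P i)"

lemma atom_index_eq:
  assumes P: "finite_measurable_partition M k P" and i: "i \<in> {1..k}" "x \<in> P i"
  shows "atom_index k P x = i"
  unfolding atom_index_def
proof (rule the_equality)
  fix j assume j: "j \<in> {1..k} \<and> x \<in> P j"
  have "disjoint (P ` {1..k})" using P by (simp add: finite_measurable_partition_def partition_on_def)
  from disjointD[OF this, of "P j" "P i"] have "P j = P i" using i j by auto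
  moreover have "inj_on P {1..k}" using P by (simp add: finite_measurable_partition_def)
  ultimately show "j = i" using inj_onD[of P "{1..k}" j i] i j by blast
qed (use i in simp)

lemma atom_index_mem:
  assumes P: "finite_measurable_partition M k P" and x: "x \<in> space M"
  shows "atom_index k P x \<in> {1..k}" "x \<in> P (atom_index k P x)"
proof -
  have "space M = \<Union> (P ` {1..k})"
    using P by (auto simp: finite_measurable_partition_def partition_on_def)
  then obtain i where i: "i \<in> {1..k}" "x \<in> P i" using x by blast
  with atom_index_eq[OF P i] show "atom_index k P x \<in> {1..k}" "x \<in> P (atom_index k P x)" by simp_all
qed

lemma measurable_atom_index:
  assumes P: "finite_measurable_partition M k P"
  shows "atom_index k P \<in> M \<rightarrow>\<^sub>M count_space {1..k}"
  unfolding measurable_count_space_eq2[OF finite_atLeastAtMost]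
proof (intro conjI ballI)
  fix i assume i: "i \<in> {1..k}"
  have "P i \<in> sets M" using P i by (auto simp: finite_measurable_partition_def)
  moreover have "atom_index k P -` {i} \<inter> space M = P i"
    using atom_index_eq[OF P i] atom_index_mem[OF P] sets.sets_into_space[OF calculation] by auto
  ultimately show "atom_index k P -` {i} \<inter> space M \<in> sets M" by simp
qed (use atom_index_mem[OF P] in auto)

lemma (in measure_preserving_flow) coloured_flow_atom_index:
  assumes P: "finite_measurable_partition M k P"
  shows "coloured_flow M T (atom_index k P)"
proof
  show "atom_index k P \<in> M \<rightarrow>\<^sub>M count_space UNIV"
    using measurable_compose[OF measurable_atom_index[OF P], of "\<lambda>i. i" "count_space UNIV"] by simp
  show "finite (atom_index k P ` space M)"
    by (rule finite_subset[OF image_subsetI finite_atLeastAtMost]) (rule atom_index_mem(1)[OF P])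
qed

text \<open>
  The name of a centre is a word, and \<open>name_dist\<close> is \<open>r\<close> times the Hamming distance of names.  What
  needs an argument is that names form a measurable map into the space of words: for a fixed word \<open>w\<close>,
  the set of times at which the name of \<open>y\<close> agrees with \<open>w\<close> is a section of a measurable subset of the
  product, so its measure depends measurably on \<open>y\<close>.
\<close>
lemma (in measure_preserving_flow) covering_number_le:
  assumes P: "finite_measurable_partition M k P" and r: "0 < r" and \<epsilon>: "0 < \<epsilon>"
    and C: "C \<subseteq> space M" "finite C"
    and large: "\<beta> - \<epsilon> < measure M {y \<in> space M. \<exists>x\<in>C. coloured_flow.name_dist T (atom_index k P) r x y < ennreal (\<epsilon> * r)}"
  shows "covering_number M T k P r \<epsilon> \<beta> \<le> enat (card C)"
proof -
  let ?c = "atom_index k P" and ?name = "orbit_name T k P r"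
  interpret coloured_flow M T ?c by (rule coloured_flow_atom_index[OF P])
  have name: "?name x = (\<lambda>t\<in>{0..r}. ?c (T t x))" for x
    by (simp add: orbit_name_def atom_index_def)
  have orbit: "(\<lambda>t. ?c (T t x)) \<in> borel \<rightarrow>\<^sub>M count_space {1..k}" if "x \<in> space M" for x
    by (rule measurable_compose[OF measurable_orbit[OF that] measurable_atom_index[OF P]])
  have word: "?name x \<in> words k r" if "x \<in> space M" for x
  proof -
    have "?name x \<in> restrict_space borel {0..r} \<rightarrow>\<^sub>M count_space {1..k}"
      unfolding name using measurable_restrict_space1[OF orbit[OF that], of "{0..r}"]
      by (subst measurable_cong[where g="\<lambda>t. ?c (T t x)"]) (simp_all add: space_restrict_space)
    then show ?thesis by (auto simp: words_def name)
  qed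
  have ball: "{y \<in> space M. ?name y \<in> hamming_ball k r w e} \<in> sets M" if w: "w \<in> words k r" for w e
  proof -
    \<comment> \<open>An extension of \<open>w\<close> that is measurable on the whole line; the value outside is arbitrary.\<close>
    define v where "v t = (if t \<in> {0..r} then w t else 0)" for t
    have [measurable]: "v \<in> borel \<rightarrow>\<^sub>M count_space UNIV"
    proof -
      have "w \<in> restrict_space borel {0..r} \<rightarrow>\<^sub>M count_space UNIV"
        using w measurable_compose[of w "restrict_space borel {0..r}" "count_space {1..k}" "\<lambda>i. i" "count_space UNIV"]
        by (simp add: words_def)
      moreover have "{t. 0 \<le> t \<and> t \<le> r} = {0..r}" by auto
      ultimately show ?thesis unfolding v_def
        by (subst measurable_If_restrict_space_iff) auto
    qed
    have eq: "{s \<in> {0..r}. w s = ?name y s} = {s \<in> {0..r}. v s = ?c (T s y)}" for y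
      by (auto simp: v_def name)
    have "(\<lambda>(y, s). (v s, ?c (T s y))) \<in> M \<Otimes>\<^sub>M lborel \<rightarrow>\<^sub>M count_space UNIV \<Otimes>\<^sub>M count_space UNIV"
      by measurable
    then have "(\<lambda>(y, s). (v s, ?c (T s y))) \<in> M \<Otimes>\<^sub>M lborel \<rightarrow>\<^sub>M count_space UNIV"
      by (simp add: pair_measure_countable)
    from measurable_compose[OF this, of "\<lambda>(i, j). i = j" "count_space UNIV"]
    have "Measurable.pred (M \<Otimes>\<^sub>M lborel) (\<lambda>z. v (snd z) = ?c (T (snd z) (fst z)))"
      by (simp add: case_prod_beta)
    then have "{z \<in> space (M \<Otimes>\<^sub>M lborel). snd z \<in> {0..r} \<and> v (snd z) = ?c (T (snd z) (fst z))} \<in> sets (M \<Otimes>\<^sub>M lborel)"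
      by measurable
    then have "(\<lambda>y. emeasure lborel {s \<in> {0..r}. v s = ?c (T s y)}) \<in> borel_measurable M"
      by (intro lborel.measurable_emeasure) (simp_all only: mem_Collect_eq space_lborel space_borel subset_UNIV)
    then have [measurable]: "(\<lambda>y. measure lborel {s \<in> {0..r}. v s = ?c (T s y)}) \<in> borel_measurable M"
      unfolding measure_def by measurable
    have "?name y \<in> hamming_ball k r w e \<longleftrightarrow> (1 / r) * (r - measure lborel {s \<in> {0..r}. v s = ?c (T s y)}) < e"
      if "y \<in> space M" for y
      using word[OF that] by (simp only: hamming_ball_def hamming_dist_def mem_Collect_eq eq simp_thms)
    then have "{y \<in> space M. ?name y \<in> hamming_ball k r w e}
        = {y \<in> space M. (1 / r) * (r - measure lborel {s \<in> {0..r}. v s = ?c (T s y)}) < e}"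
      by (intro Collect_cong conj_cong refl)
    also have "\<dots> \<in> sets M" by measurable
    finally show ?thesis .
  qed
  have dist: "name_dist r x y = ennreal (r * hamming_dist r (?name x) (?name y))"
    if x[measurable]: "x \<in> space M" and y[measurable]: "y \<in> space M" for x y
  proof -
    define A where "A = {s \<in> {0..r}. ?name x s = ?name y s}"
    have A: "A = {s. 0 \<le> s \<and> s \<le> r \<and> disagree (T s x) (T s y) = 0}"
      by (auto simp: A_def name disagree_def)
    have "{s \<in> space borel. 0 \<le> s \<and> s \<le> r \<and> disagree (T s x) (T s y) = 0} \<in> sets borel"
      by measurable
    then have [measurable]: "A \<in> sets borel" unfolding A by simp
    have sub: "A \<subseteq> {0..r}" by (auto simp: A_def)
    have "emeasure lborel A \<le> emeasure lborel {0..r}" using sub by (intro emeasure_mono) auto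
    also have "\<dots> < \<infinity>" using r by simp
    finally have fin: "emeasure lborel A \<noteq> top" by simp
    note emA = emeasure_eq_ennreal_measure[OF fin] fin
    have "(\<lambda>s. disagree (T s x) (T s y)) \<in> borel_measurable borel" by measurable
    then have "name_dist r x y = (\<integral>\<^sup>+s. disagree (T s x) (T s y) * indicator {0..<r} s \<partial>lborel)"
      unfolding name_dist_def by (rule nn_integral_window)
    \<comment> \<open>The distance \<open>name_dist\<close> uses the half-open interval, the Hamming distance the closed one.\<close>
    also have "\<dots> = (\<integral>\<^sup>+s. indicator ({0..r} - A) s \<partial>lborel)"
    proof (rule nn_integral_cong_AE, rule AE_mp[OF AE_lborel_singleton[of r]], intro AE_I2 impI)
      fix s :: real assume "s \<noteq> r"
      then show "disagree (T s x) (T s y) * indicator {0..<r} s = indicator ({0..r} - A) s"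
        by (cases "s \<in> {0..<r}") (auto simp: A disagree_def)
    qed
    also have "\<dots> = emeasure lborel ({0..r} - A)" by simp
    also have "\<dots> = ennreal (r - measure lborel A)"
      using emA sub r by (subst emeasure_Diff) (auto simp: ennreal_minus)
    also have "r - measure lborel A = r * hamming_dist r (?name x) (?name y)"
      using r by (simp add: hamming_dist_def A_def)
    finally show ?thesis .
  qed
  let ?\<Sigma> = "sigma (words k r) {hamming_ball k r w e |w e. w \<in> words k r \<and> 0 < e}"
  have gen: "{hamming_ball k r w e |w e. w \<in> words k r \<and> 0 < e} \<subseteq> Pow (words k r)"
    by (auto simp: hamming_ball_def)
  have name_meas: "?name \<in> M \<rightarrow>\<^sub>M ?\<Sigma>"
  proof (rule measurable_measure_of[OF gen])
    show "?name \<in> space M \<rightarrow> words k r" using word by auto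
  next
    fix X assume "X \<in> {hamming_ball k r w e |w e. w \<in> words k r \<and> 0 < e}"
    then obtain w e where "X = hamming_ball k r w e" "w \<in> words k r" by auto
    moreover have "?name -` X \<inter> space M = {y \<in> space M. ?name y \<in> X}" by auto
    ultimately show "?name -` X \<inter> space M \<in> sets M" using ball by simp
  qed
  define U where "U = (\<Union>w\<in>?name ` C. hamming_ball k r w \<epsilon>)"
  have "U \<in> sets ?\<Sigma>"
    unfolding U_def
  proof (intro sets.finite_UN)
    fix w assume "w \<in> ?name ` C"
    then have "w \<in> words k r" using C word by auto
    then show "hamming_ball k r w \<epsilon> \<in> sets ?\<Sigma>"
      using \<epsilon> gen by (auto simp: sets_measure_of intro!: sigma_sets.Basic)
  qed (use C in simp)
  then have "measure (name_measure M T k P r) U = measure M (?name -` U \<inter> space M)"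
    unfolding name_measure_def by (intro measure_distr name_meas)
  also have "?name -` U \<inter> space M = {y \<in> space M. \<exists>x\<in>C. name_dist r x y < ennreal (\<epsilon> * r)}"
  proof -
    have "?name y \<in> hamming_ball k r (?name x) \<epsilon> \<longleftrightarrow> name_dist r x y < ennreal (\<epsilon> * r)"
      if "x \<in> C" "y \<in> space M" for x y
    proof -
      have "ennreal a < ennreal b \<longleftrightarrow> a < b" if "0 < b" for a b
        by (metis ennreal_lessI ennreal_leI not_le that)
      then have "name_dist r x y < ennreal (\<epsilon> * r) \<longleftrightarrow> r * hamming_dist r (?name x) (?name y) < \<epsilon> * r"
        using that C r \<epsilon> by (simp add: dist subset_iff)
      also have "\<dots> \<longleftrightarrow> hamming_dist r (?name x) (?name y) < \<epsilon>"
        using r by (simp add: mult.commute)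
      finally show ?thesis using word[OF that(2)] by (simp add: hamming_ball_def)
    qed
    then show ?thesis by (auto simp: U_def)
  qed
  finally have "\<beta> - \<epsilon> < measure (name_measure M T k P r) U" using large by simp
  then have "covering_number M T k P r \<epsilon> \<beta> \<le> enat (card (?name ` C))"
    unfolding covering_number_def U_def using C word by (intro INF_lower) auto
  also have "\<dots> \<le> enat (card C)" using C by (simp add: card_image_le)
  finally show ?thesis .
qed

section \<open>Spread of names within a level\<close>

lemma measurable_map_count_space:
  fixes f :: "'i \<Rightarrow> 'a \<Rightarrow> 'b::countable"
  assumes "\<And>j. j \<in> set js \<Longrightarrow> f j \<in> L \<rightarrow>\<^sub>M count_space UNIV"
  shows "(\<lambda>x. map (\<lambda>j. f j x) js) \<in> L \<rightarrow>\<^sub>M count_space UNIV"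
  using assms
proof (induction js)
  case (Cons j js)
  then have "(\<lambda>x. (f j x, map (\<lambda>j. f j x) js)) \<in> L \<rightarrow>\<^sub>M count_space UNIV \<Otimes>\<^sub>M count_space UNIV"
    by (intro measurable_Pair) auto
  then have "(\<lambda>x. (f j x, map (\<lambda>j. f j x) js)) \<in> L \<rightarrow>\<^sub>M count_space UNIV"
    by (simp add: pair_measure_countable)
  from measurable_compose[OF this, of "\<lambda>(a, as). a # as" "count_space UNIV"]
  show ?case by simp
qed simp

context coloured_flow
begin

definition itinerary :: "real \<Rightarrow> nat \<Rightarrow> 'a \<Rightarrow> nat list" where
  "itinerary \<eta> n x = map (\<lambda>j. c (T (real j * \<eta>) x)) [0..<n]"

definition itinerary_mismatch :: "real \<Rightarrow> nat \<Rightarrow> 'a \<Rightarrow> 'a \<Rightarrow> ennreal" where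
  "itinerary_mismatch \<eta> n x y = of_bool (itinerary \<eta> n x \<noteq> itinerary \<eta> n y)"

definition sampling_error :: "real \<Rightarrow> real \<Rightarrow> 'a \<Rightarrow> ennreal" where
  "sampling_error \<eta> r x = (\<integral>\<^sup>+\<tau>. disagree (T \<tau> x) (T (of_int \<lfloor>\<tau> / \<eta>\<rfloor> * \<eta>) x) \<partial>window 0 r)"

lemma measurable_itinerary [measurable]: "itinerary \<eta> n \<in> M \<rightarrow>\<^sub>M count_space UNIV"
  unfolding itinerary_def by (intro measurable_map_count_space) measurable

lemma measurable_itinerary_mismatch [measurable (raw)]:
  assumes "f \<in> L \<rightarrow>\<^sub>M M" "g \<in> L \<rightarrow>\<^sub>M M"
  shows "(\<lambda>z. itinerary_mismatch \<eta> n (f z) (g z)) \<in> borel_measurable L"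
  unfolding itinerary_mismatch_def
  by (intro measurable_of_bool_neq measurable_compose[OF _ measurable_itinerary] assms)

lemma finite_itineraries: "finite (itinerary \<eta> n ` space M)"
  by (rule finite_subset[OF _ finite_lists_length_eq[OF finite_colours, of n]]) (auto simp: itinerary_def)

lemma itinerary_eq_imp:
  assumes "itinerary \<eta> n x = itinerary \<eta> n y" "j < n"
  shows "c (T (real j * \<eta>) x) = c (T (real j * \<eta>) y)"
  using assms by (auto simp: itinerary_def)

lemma itinerary_refines_colour:
  assumes "itinerary \<eta> n x = itinerary \<eta> n y" "0 < n" "x \<in> space M" "y \<in> space M"
  shows "c x = c y"
  using itinerary_eq_imp[OF assms(1,2)] assms(3,4) by (simp add: flow_zero)

lemma measurable_sampling_error [measurable]: "sampling_error \<eta> r \<in> borel_measurable M"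
proof -
  interpret I: sigma_finite_measure "window 0 r" by simp
  show ?thesis unfolding sampling_error_def by measurable
qed

text \<open>
  At each time \<open>\<tau>\<close> the nearest earlier sampling time is less than \<open>\<eta>\<close> away, so the invariant measure of
  the points whose colour differs at these two times is at most \<open>\<xi>\<close>.
\<close>
lemma nn_integral_sampling_error:
  assumes \<eta>: "0 < \<eta>" and r: "0 \<le> r"
    and \<xi>: "\<And>v. \<bar>v\<bar> \<le> \<eta> \<Longrightarrow> (\<integral>\<^sup>+x. disagree x (T v x) \<partial>M) \<le> ennreal \<xi>"
  shows "(\<integral>\<^sup>+x. sampling_error \<eta> r x \<partial>M) \<le> ennreal r * ennreal \<xi>"
proof -
  interpret P: pair_sigma_finite "window 0 r" M
    by (simp add: pair_sigma_finite_def sigma_finite_measure_axioms)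
  have "(\<integral>\<^sup>+x. sampling_error \<eta> r x \<partial>M)
      = (\<integral>\<^sup>+\<tau>. \<integral>\<^sup>+x. disagree (T \<tau> x) (T (of_int \<lfloor>\<tau> / \<eta>\<rfloor> * \<eta>) x) \<partial>M \<partial>window 0 r)"
    unfolding sampling_error_def by (rule P.Fubini') measurable
  also have "\<dots> \<le> (\<integral>\<^sup>+\<tau>. ennreal \<xi> \<partial>window 0 r)"
  proof (rule nn_integral_mono)
    fix \<tau>
    define v where "v = of_int \<lfloor>\<tau> / \<eta>\<rfloor> * \<eta> - \<tau>"
    have "of_int \<lfloor>\<tau> / \<eta>\<rfloor> * \<eta> \<le> \<tau>"
      by (rule pos_le_divide_eq[OF \<eta>, THEN iffD1, OF of_int_floor_le])
    moreover have "\<tau> < (of_int \<lfloor>\<tau> / \<eta>\<rfloor> + 1) * \<eta>"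
      by (rule pos_divide_less_eq[OF \<eta>, THEN iffD1, OF real_of_int_floor_add_one_gt])
    ultimately have v: "\<bar>v\<bar> \<le> \<eta>" by (simp add: v_def algebra_simps)
    have "(\<integral>\<^sup>+x. disagree (T \<tau> x) (T (of_int \<lfloor>\<tau> / \<eta>\<rfloor> * \<eta>) x) \<partial>M) = (\<integral>\<^sup>+x. disagree (T \<tau> x) (T v (T \<tau> x)) \<partial>M)"
      by (intro nn_integral_cong) (simp add: flow_add[symmetric] v_def)
    also have "\<dots> = (\<integral>\<^sup>+x. disagree x (T v x) \<partial>M)"
      by (rule nn_integral_flow) measurable
    finally show "(\<integral>\<^sup>+x. disagree (T \<tau> x) (T (of_int \<lfloor>\<tau> / \<eta>\<rfloor> * \<eta>) x) \<partial>M) \<le> ennreal \<xi>"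
      using \<xi>[OF v] by simp
  qed
  also have "\<dots> = ennreal r * ennreal \<xi>" using r by (simp add: mult.commute)
  finally show ?thesis .
qed

text \<open>
  If the itineraries agree, the names can differ at time \<open>\<tau>\<close> only when one of the two colours at \<open>\<tau>\<close>
  differs from the colour at the preceding sampling time.
\<close>
lemma name_dist_le_itinerary:
  assumes x[measurable]: "x \<in> space M" and y[measurable]: "y \<in> space M"
    and \<eta>: "0 < \<eta>" and r: "0 \<le> r" "r \<le> real n * \<eta>"
  shows "name_dist r x y \<le> ennreal r * itinerary_mismatch \<eta> n x y
    + sampling_error \<eta> r x + sampling_error \<eta> r y"
proof (cases "itinerary \<eta> n x = itinerary \<eta> n y")
  case False
  have "name_dist r x y \<le> (\<integral>\<^sup>+\<tau>. 1 \<partial>window 0 r)"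
    unfolding name_dist_def by (intro nn_integral_mono) (simp add: disagree_def)
  then have "name_dist r x y \<le> ennreal r" using r by simp
  then show ?thesis using False by (simp add: itinerary_mismatch_def add_increasing2 add.assoc)
next
  case True
  let ?s = "\<lambda>\<tau>. of_int \<lfloor>\<tau> / \<eta>\<rfloor> * \<eta>"
  have "name_dist r x y \<le> (\<integral>\<^sup>+\<tau>. disagree (T \<tau> x) (T (?s \<tau>) x) + disagree (T \<tau> y) (T (?s \<tau>) y) \<partial>window 0 r)"
    unfolding name_dist_def
  proof (rule nn_integral_mono_AE, rule AE_mp[OF AE_window], intro AE_I2 impI)
    fix \<tau> assume \<tau>: "0 \<le> \<tau> \<and> \<tau> < r"
    define j where "j = nat \<lfloor>\<tau> / \<eta>\<rfloor>"
    have "0 \<le> \<tau> / \<eta>" using \<tau> \<eta> by simp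
    then have j: "real j = of_int \<lfloor>\<tau> / \<eta>\<rfloor>" by (simp add: j_def)
    have "\<tau> / \<eta> < real n" using \<tau> r \<eta> by (simp add: field_simps)
    then have "real j < real n" using j by linarith
    then have "j < n" by (simp only: of_nat_less_iff)
    then have "c (T (?s \<tau>) x) = c (T (?s \<tau>) y)"
      using itinerary_eq_imp[OF True, of j] by (simp add: j)
    then show "disagree (T \<tau> x) (T \<tau> y) \<le> disagree (T \<tau> x) (T (?s \<tau>) x) + disagree (T \<tau> y) (T (?s \<tau>) y)"
      by (auto simp: disagree_def)
  qed
  also have "\<dots> = sampling_error \<eta> r x + sampling_error \<eta> r y"
    unfolding sampling_error_def by (rule nn_integral_add) measurable
  finally show ?thesis using True by (simp add: itinerary_mismatch_def)
qed

end

context flow_over_base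
begin

text \<open>
  The bound for orbits that stay in the tower: the colours seen from level \<open>s\<close> are those of the levels
  above it, and all these lie below \<open>H\<close>.
\<close>
lemma level_spread_le_tower:
  fixes \<theta> :: "'a \<Rightarrow> 'b"
  assumes refine: "\<And>x y. x \<in> space M \<Longrightarrow> y \<in> space M \<Longrightarrow> \<theta> x = \<theta> y \<Longrightarrow> c x = c y"
    and s: "0 \<le> s" "s + r \<le> H"
  shows "level_spread r s
    \<le> (\<integral>\<^sup>+t. \<integral>\<^sup>+x. \<integral>\<^sup>+y. of_bool (\<theta> (T t x) \<noteq> \<theta> (T t y)) \<partial>W \<partial>W \<partial>window 0 H)"
proof -
  interpret P: pair_sigma_finite "window 0 r" W
    by (simp add: pair_sigma_finite_def W.sigma_finite_measure_axioms)
  define q where "q t = (\<integral>\<^sup>+x. \<integral>\<^sup>+y. disagree (T t x) (T t y) \<partial>W \<partial>W)" for t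
  have [measurable]: "q \<in> borel_measurable borel" unfolding q_def by measurable
  have add: "T \<tau> (T s x) = T (s + \<tau>) x" if "x \<in> space M" for \<tau> x
    using that by (simp add: flow_add[symmetric] add.commute)
  have "level_spread r s
      = (\<integral>\<^sup>+x. \<integral>\<^sup>+y. \<integral>\<^sup>+\<tau>. disagree (T (s + \<tau>) x) (T (s + \<tau>) y) \<partial>window 0 r \<partial>W \<partial>W)"
    unfolding level_spread_def name_dist_def
    by (intro nn_integral_cong) (simp add: add space_W)
  also have "\<dots> = (\<integral>\<^sup>+x. \<integral>\<^sup>+\<tau>. \<integral>\<^sup>+y. disagree (T (s + \<tau>) x) (T (s + \<tau>) y) \<partial>W \<partial>window 0 r \<partial>W)"
    by (intro nn_integral_cong P.Fubini') (simp add: space_W)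
  also have "\<dots> = (\<integral>\<^sup>+\<tau>. q (s + \<tau>) \<partial>window 0 r)"
    unfolding q_def by (intro P.Fubini') measurable
  also have "\<dots> = (\<integral>\<^sup>+t. q t \<partial>window s (s + r))"
    using nn_integral_window_shift[of q s "s + r" s] by simp
  also have "\<dots> \<le> (\<integral>\<^sup>+t. q t \<partial>window 0 H)"
    using s by (intro nn_integral_window_mono) auto
  also have "\<dots> \<le> (\<integral>\<^sup>+t. \<integral>\<^sup>+x. \<integral>\<^sup>+y. of_bool (\<theta> (T t x) \<noteq> \<theta> (T t y)) \<partial>W \<partial>W \<partial>window 0 H)"
    unfolding q_def
  proof (rule nn_integral_mono, rule nn_integral_mono, rule nn_integral_mono)
    fix t x y assume "x \<in> space W" "y \<in> space W"
    then show "disagree (T t x) (T t y) \<le> of_bool (\<theta> (T t x) \<noteq> \<theta> (T t y))"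
      using refine[of "T t x" "T t y"] by (auto simp: disagree_def space_W)
  qed
  finally show ?thesis .
qed

text \<open>
  The bound for orbits that may leave the tower: it uses only how the itineraries are distributed over
  the levels, together with the sampling error.
\<close>
lemma nn_integral_level_spread_le_itinerary:
  assumes \<eta>: "0 < \<eta>" and r: "0 \<le> r" "r \<le> real n * \<eta>"
  shows "(\<integral>\<^sup>+s. level_spread r s \<partial>window 0 H)
    \<le> ennreal r * (\<integral>\<^sup>+s. \<integral>\<^sup>+x. \<integral>\<^sup>+y. itinerary_mismatch \<eta> n (T s x) (T s y) \<partial>W \<partial>W \<partial>window 0 H)
      + 2 * emeasure W (space M) * (\<integral>\<^sup>+x. sampling_error \<eta> r x \<partial>slab 0 H)"
proof -
  let ?w = "emeasure W (space M)"
  define p where "p s = (\<integral>\<^sup>+x. \<integral>\<^sup>+y. itinerary_mismatch \<eta> n (T s x) (T s y) \<partial>W \<partial>W)" for s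
  define e where "e s = (\<integral>\<^sup>+x. sampling_error \<eta> r (T s x) \<partial>W)" for s
  have [measurable]: "p \<in> borel_measurable borel" unfolding p_def by measurable
  have [measurable]: "e \<in> borel_measurable borel" unfolding e_def by measurable
  have bound: "level_spread r s \<le> ennreal r * p s + 2 * ?w * e s" for s
  proof -
    have "level_spread r s \<le> (\<integral>\<^sup>+x. \<integral>\<^sup>+y. ennreal r * itinerary_mismatch \<eta> n (T s x) (T s y)
        + sampling_error \<eta> r (T s x) + sampling_error \<eta> r (T s y) \<partial>W \<partial>W)"
      unfolding level_spread_def
      by (rule nn_integral_mono, rule nn_integral_mono, rule name_dist_le_itinerary[OF _ _ \<eta> r])
        (simp_all add: space_W)
    also have "\<dots> = (\<integral>\<^sup>+x. ennreal r * (\<integral>\<^sup>+y. itinerary_mismatch \<eta> n (T s x) (T s y) \<partial>W)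
        + ?w * sampling_error \<eta> r (T s x) + e s \<partial>W)"
    proof (rule nn_integral_cong)
      fix x assume "x \<in> space W"
      then have [measurable]: "x \<in> space M" by (simp add: space_W)
      have [measurable]: "(\<lambda>y. itinerary_mismatch \<eta> n (T s x) (T s y)) \<in> borel_measurable W" by measurable
      show "(\<integral>\<^sup>+y. ennreal r * itinerary_mismatch \<eta> n (T s x) (T s y)
          + sampling_error \<eta> r (T s x) + sampling_error \<eta> r (T s y) \<partial>W)
        = ennreal r * (\<integral>\<^sup>+y. itinerary_mismatch \<eta> n (T s x) (T s y) \<partial>W) + ?w * sampling_error \<eta> r (T s x) + e s"
        unfolding e_def by (simp add: nn_integral_add nn_integral_cmult space_W mult.commute)
    qed
    also have "\<dots> = ennreal r * p s + ?w * e s + e s * ?w"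
      unfolding p_def e_def by (simp add: nn_integral_add nn_integral_cmult space_W)
    also have "\<dots> = ennreal r * p s + 2 * ?w * e s"
      by (simp add: algebra_simps mult_2_right flip: mult_2)
    finally show ?thesis .
  qed
  have "(\<integral>\<^sup>+s. level_spread r s \<partial>window 0 H) \<le> (\<integral>\<^sup>+s. ennreal r * p s + 2 * ?w * e s \<partial>window 0 H)"
    by (intro nn_integral_mono bound)
  also have "\<dots> = ennreal r * (\<integral>\<^sup>+s. p s \<partial>window 0 H) + 2 * ?w * (\<integral>\<^sup>+s. e s \<partial>window 0 H)"
    by (simp add: nn_integral_add nn_integral_cmult)
  also have "(\<integral>\<^sup>+s. e s \<partial>window 0 H) = (\<integral>\<^sup>+x. sampling_error \<eta> r x \<partial>slab 0 H)"
    unfolding e_def by (rule nn_integral_slab[symmetric]) measurable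
  finally show ?thesis unfolding p_def .
qed

end

section \<open>Linearly many balls cover the names\<close>

lemma (in flow_over_base) slab_good_set:
  assumes r: "0 < r" and H': "0 < H'" and h0: "0 < h0" and w: "0 < measure W (space M)"
    and \<epsilon>: "0 < \<epsilon>" and \<xi>0: "0 \<le> \<xi>" and D: "0 \<le> D"
    and slab: "\<And>A. A \<in> sets M \<Longrightarrow> emeasure (slab 0 H') A \<le> emeasure M A"
    and \<xi>: "\<And>v. \<bar>v\<bar> \<le> h0 \<Longrightarrow> (\<integral>\<^sup>+x. disagree x (T v x) \<partial>M) \<le> ennreal \<xi>"
    and level: "(\<integral>\<^sup>+s. level_spread r s \<partial>window 0 H') \<le> ennreal (measure W (space M) * (D * r))"
  shows "\<exists>C. C \<subseteq> space M \<and> finite C \<and> real (card C) \<le> H' / h0 + 1 \<and>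
    H' * measure W (space M) - (D + 2 * \<xi>) / \<epsilon>
      \<le> measure M {y \<in> space M. \<exists>x\<in>C. name_dist r x y < ennreal (\<epsilon> * r)}"
proof -
  let ?w = "measure W (space M)"
  have emW: "emeasure W (space M) = ennreal ?w" by (simp add: W.emeasure_eq_measure)
  \<comment> \<open>The thickness \<open>h\<close> is at most \<open>h0\<close>, also when \<open>H'\<close> is smaller than \<open>h0\<close>, and divides \<open>H'\<close> evenly.\<close>
  define J where "J = nat \<lceil>H' / h0\<rceil>"
  have pos: "0 < H' / h0" using H' h0 by simp
  then have J: "0 < J" "H' / h0 \<le> real J" "real J \<le> H' / h0 + 1"
    unfolding J_def by linarith+
  define h where "h = H' / real J"
  have h: "0 < h" "real J * h = H'" using J H' by (auto simp: h_def)
  have "h \<le> h0" using J h0 by (simp add: h_def field_simps)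
  then have "\<exists>C. C \<subseteq> space M \<and> finite C \<and> card C \<le> J \<and>
    ennreal (\<epsilon> * r) * emeasure (slab 0 (real J * h)) {y \<in> space M. \<forall>x\<in>C. ennreal (\<epsilon> * r) \<le> name_dist r x y}
      \<le> ennreal (D * r) + 2 * (ennreal r * ennreal \<xi>)"
    using r J(1) h(1) w D slab level unfolding emW h(2)[symmetric]
    by (intro slab_covering \<xi>) (auto simp: emW ennreal_mult)
  then obtain C where C: "C \<subseteq> space M" "finite C" "card C \<le> J"
    and bad: "ennreal (\<epsilon> * r) * emeasure (slab 0 H') {y \<in> space M. \<forall>x\<in>C. ennreal (\<epsilon> * r) \<le> name_dist r x y}
      \<le> ennreal (D * r) + 2 * (ennreal r * ennreal \<xi>)"
    unfolding h(2) by blast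
  interpret L: finite_measure "slab 0 H'" by (rule finite_measure_slab)
  define Bad where "Bad = {y \<in> space M. \<forall>x\<in>C. ennreal (\<epsilon> * r) \<le> name_dist r x y}"
  define Good where "Good = {y \<in> space M. \<exists>x\<in>C. name_dist r x y < ennreal (\<epsilon> * r)}"
  have "{y \<in> space M. ennreal (\<epsilon> * r) \<le> name_dist r x y} \<in> sets M" if "x \<in> C" for x
  proof -
    have [measurable]: "x \<in> space M" using that C by auto
    show ?thesis by measurable
  qed
  then have Bad: "Bad \<in> sets M" unfolding Bad_def using C(2) by (intro sets.sets_Collect_finite_All)
  have Good_eq: "Good = space M - Bad" by (auto simp: Good_def Bad_def not_le)
  then have Good: "Good \<in> sets M" using Bad by auto
  have "ennreal (\<epsilon> * r * measure (slab 0 H') Bad) \<le> ennreal ((D + 2 * \<xi>) * r)"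
    using bad \<epsilon> r \<xi>0 D
    by (simp add: Bad_def[symmetric] L.emeasure_eq_measure algebra_simps
        flip: ennreal_mult ennreal_plus ennreal_numeral)
  then have "\<epsilon> * measure (slab 0 H') Bad * r \<le> (D + 2 * \<xi>) * r"
    using r \<xi>0 D by (subst (asm) ennreal_le_iff) (auto simp: mult_ac)
  then have "\<epsilon> * measure (slab 0 H') Bad \<le> D + 2 * \<xi>"
    using r by (rule mult_right_le_imp_le)
  then have bad': "measure (slab 0 H') Bad \<le> (D + 2 * \<xi>) / \<epsilon>"
    using \<epsilon> by (simp add: pos_le_divide_eq mult.commute)
  have "ennreal (measure (slab 0 H') (space M)) = ennreal (H' * ?w)"
    unfolding L.emeasure_eq_measure[symmetric] using H' by (simp add: emeasure_slab_space emW ennreal_mult)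
  then have "measure (slab 0 H') (space M) = H' * ?w" using H' by (simp add: ennreal_inj)
  then have "measure (slab 0 H') Good = H' * ?w - measure (slab 0 H') Bad"
    using L.finite_measure_compl[of Bad] Bad by (simp add: Good_eq)
  moreover have "measure (slab 0 H') Good \<le> measure M Good"
    using slab[OF Good] by (simp add: L.emeasure_eq_measure emeasure_eq_measure)
  ultimately have "H' * ?w - (D + 2 * \<xi>) / \<epsilon> \<le> measure M Good" using bad' by linarith
  moreover have "real (card C) \<le> H' / h0 + 1" using C(3) J(3) by linarith
  ultimately show ?thesis using C(1,2) unfolding Good_def by blast
qed

text \<open>
  The length \<open>r\<close> is \<open>\<kappa> H\<close> for a tall tower and \<open>R\<close> for a short one.  In both cases the height is at most
  \<open>r / \<kappa>\<close>, which makes the number of slabs linear in \<open>r\<close>.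
\<close>
lemma (in coloured_flow) names_covering:
  assumes rank: "beta_rank_one_flow M T \<beta>" and \<beta>: "0 < \<beta>" and \<epsilon>: "0 < \<epsilon>" "\<epsilon> < 1"
  shows "\<exists>K>0. \<forall>R\<ge>1. \<exists>r\<ge>R. \<exists>C. C \<subseteq> space M \<and> finite C \<and> real (card C) \<le> K * r \<and>
    \<beta> - \<epsilon> < measure M {y \<in> space M. \<exists>x\<in>C. name_dist r x y < ennreal (\<epsilon> * r)}"
proof -
  \<comment> \<open>The measure lost is at most \<open>\<delta>\<close> outside the tower, \<open>\<kappa>\<close> near its top, and \<open>(3\<delta> / \<kappa> + 4\<xi>) / \<epsilon>\<close>
    in the slabs; each of the three is at most \<open>\<epsilon> / 4\<close>.  The bound \<open>\<delta> \<le> \<beta>\<close> makes the tower nonnull.\<close>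
  define \<kappa> where "\<kappa> = \<epsilon> / 4"
  define \<xi> where "\<xi> = \<epsilon>\<^sup>2 / 32"
  define \<delta> where "\<delta> = min (\<kappa> * \<epsilon>\<^sup>2 / 24) \<beta>"
  have \<epsilon>2: "0 < \<epsilon>\<^sup>2" "\<epsilon>\<^sup>2 < 1" using \<epsilon> by (auto simp: power_less_one_iff)
  have \<kappa>: "0 < \<kappa>" "\<kappa> < 1" using \<epsilon> by (auto simp: \<kappa>_def)
  have "\<kappa> * \<epsilon>\<^sup>2 \<le> \<kappa> * 1" using \<kappa> \<epsilon>2 by (intro mult_left_mono) auto
  moreover have small: "\<delta> \<le> \<kappa> * \<epsilon>\<^sup>2 / 24" by (simp add: \<delta>_def)
  ultimately have "\<delta> \<le> \<epsilon> / 4" "\<delta> < 1" using \<epsilon> unfolding \<kappa>_def by linarith+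
  moreover have "3 * \<delta> / \<kappa> \<le> \<epsilon>\<^sup>2 / 8" using small \<kappa>(1) by (simp add: pos_divide_le_eq mult_ac)
  moreover have "0 < \<delta>" "\<delta> \<le> \<beta>" using \<beta> \<epsilon>2 \<kappa> by (simp_all add: \<delta>_def)
  ultimately have \<delta>: "0 < \<delta>" "\<delta> < 1" "\<delta> \<le> \<epsilon> / 4" "\<delta> \<le> \<beta>" "3 * \<delta> / \<kappa> \<le> \<epsilon>\<^sup>2 / 8"
    by simp_all
  have \<xi>0: "0 < \<xi>" using \<epsilon> by (simp add: \<xi>_def)
  obtain h0 where h0: "0 < h0"
    and cont: "\<And>v. \<bar>v\<bar> \<le> h0 \<Longrightarrow> (\<integral>\<^sup>+x. disagree x (T v x) \<partial>M) \<le> ennreal \<xi>"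
    using colour_continuity[OF \<xi>0] by blast
  define K where "K = 1 / (\<kappa> * h0) + 1"
  have "\<exists>r\<ge>R. \<exists>C. C \<subseteq> space M \<and> finite C \<and> real (card C) \<le> K * r \<and>
    \<beta> - \<epsilon> < measure M {y \<in> space M. \<exists>x\<in>C. name_dist r x y < ennreal (\<epsilon> * r)}" if R: "1 \<le> R" for R
  proof -
    define n where "n = nat \<lceil>R / h0\<rceil>"
    have "0 < R / h0" using R h0 by simp
    then have n: "0 < n" "R / h0 \<le> real n" unfolding n_def by linarith+
    then have nR: "R \<le> real n * h0" using h0 by (simp add: field_simps)
    obtain H W where H: "0 < H" and W: "finite_measure W" "sets W = sets M"
      and mass: "\<beta> - \<delta> < H * measure W (space M)"
      and le: "\<And>A. A \<in> sets M \<Longrightarrow> (\<integral>\<^sup>+s\<in>{0..<H}. emeasure W {y \<in> space M. T s y \<in> A} \<partial>lborel) \<le> emeasure M A"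
      and mismatch: "(\<integral>\<^sup>+s. \<integral>\<^sup>+x. \<integral>\<^sup>+y. of_bool (itinerary h0 n (T s x) \<noteq> itinerary h0 n (T s y)) \<partial>W \<partial>W \<partial>window 0 H)
       \<le> ennreal (3 * \<delta> * H * (measure W (space M))\<^sup>2)"
      using rank_one_tower[OF rank \<delta>(1,2) measurable_itinerary finite_itineraries] by blast
    interpret W: finite_measure W by fact
    interpret flow_over_base M T c W using W(2) by unfold_locales
    define w where "w = measure W (space M)"
    have emW: "emeasure W (space M) = ennreal w" by (simp add: w_def W.emeasure_eq_measure)
    have wH: "\<beta> - \<delta> < H * w" using mass by (simp add: w_def)
    then have "0 < H * w" using \<delta>(4) by linarith
    then have w: "0 < w" using H by (simp add: zero_less_mult_iff)
    have slab_le: "emeasure (slab 0 H) A \<le> emeasure M A" if A[measurable]: "A \<in> sets M" for A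
    proof -
      have inner: "(\<integral>\<^sup>+y. indicator A (T s y) \<partial>W) = emeasure W {y \<in> space M. T s y \<in> A}" for s
      proof -
        have "(\<integral>\<^sup>+y. indicator A (T s y) \<partial>W) = (\<integral>\<^sup>+y. indicator {y \<in> space M. T s y \<in> A} y \<partial>W)"
          by (intro nn_integral_cong) (simp add: indicator_def space_W)
        also have "\<dots> = emeasure W {y \<in> space M. T s y \<in> A}"
          by (rule nn_integral_indicator) (unfold sets_W, measurable)
        finally show ?thesis .
      qed
      have "(\<lambda>s. \<integral>\<^sup>+y. indicator A (T s y) \<partial>W) \<in> borel_measurable borel" by measurable
      from nn_integral_window[OF this, of 0 H] show ?thesis
        using le[OF A] unfolding emeasure_slab[OF A] inner by simp
    qed
    have wH1: "H * w \<le> 1"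
      using slab_le[OF sets.top] H w by (simp add: emeasure_slab_space emW emeasure_space_1 flip: ennreal_mult)
    define E where "E = 3 * \<delta> * H * w\<^sup>2"
    have E0: "0 \<le> E" using \<delta>(1) H by (simp add: E_def)
    have EwH: "E \<le> w * (3 * \<delta>)"
      using mult_left_mono[OF wH1, of "3 * \<delta> * w"] \<delta>(1) w by (simp add: E_def power2_eq_square mult_ac)
    \<comment> \<open>Both choices of the name length \<open>r\<close> below end with this estimate.\<close>
    have finish: ?thesis
      if r: "R \<le> r" "H' \<le> r / \<kappa>" "0 < H'" "H' \<le> H" "H * w - \<kappa> \<le> H' * w"
        and level: "(\<integral>\<^sup>+s. level_spread r s \<partial>window 0 H') \<le> ennreal (w * ((3 * \<delta> / \<kappa> + 2 * \<xi>) * r))" for r H'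
    proof -
      have slab': "emeasure (slab 0 H') A \<le> emeasure M A" if A[measurable]: "A \<in> sets M" for A
      proof -
        have "(\<lambda>s. \<integral>\<^sup>+y. indicator A (T s y) \<partial>W) \<in> borel_measurable borel" by measurable
        from nn_integral_window_mono[OF this order.refl r(4)] show ?thesis
          using slab_le[OF A] unfolding emeasure_slab[OF A] by (rule order_trans)
      qed
      have r0: "0 < r" using r R by linarith
      obtain C where C: "C \<subseteq> space M" "finite C" "real (card C) \<le> H' / h0 + 1"
        and large: "H' * w - (3 * \<delta> / \<kappa> + 2 * \<xi> + 2 * \<xi>) / \<epsilon>
          \<le> measure M {y \<in> space M. \<exists>x\<in>C. name_dist r x y < ennreal (\<epsilon> * r)}"
        using slab_good_set[OF r0 r(3) h0 w[unfolded w_def] \<epsilon>(1) order.strict_implies_order[OF \<xi>0] _ slab' cont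
            level[unfolded w_def]] \<delta>(1) \<kappa>(1) \<xi>0 unfolding w_def by (auto simp: add_nonneg_nonneg)
      have "(3 * \<delta> / \<kappa> + 2 * \<xi> + 2 * \<xi>) / \<epsilon> \<le> (\<epsilon>\<^sup>2 / 4) / \<epsilon>"
        using \<delta>(5) \<epsilon> by (intro divide_right_mono) (auto simp: \<xi>_def)
      also have "\<dots> = \<epsilon> / 4" using \<epsilon> by (simp add: power2_eq_square)
      finally have "\<beta> - \<epsilon> < H' * w - (3 * \<delta> / \<kappa> + 2 * \<xi> + 2 * \<xi>) / \<epsilon>"
        using r(5) wH \<delta>(3) \<epsilon> unfolding \<kappa>_def by linarith
      moreover have "H' / h0 + 1 \<le> K * r"
      proof -
        have "H' / h0 \<le> (r / \<kappa>) / h0" using r(2) h0 by (intro divide_right_mono) auto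
        then show ?thesis using r(1) R by (simp add: K_def algebra_simps)
      qed
      ultimately show ?thesis using C large r(1) by (intro exI[of _ r] conjI exI[of _ C]) auto
    qed
    show ?thesis
    proof (cases "\<kappa> * H \<le> R")
      case True
      have "(\<integral>\<^sup>+s. level_spread R s \<partial>window 0 H)
          \<le> ennreal R * (\<integral>\<^sup>+s. \<integral>\<^sup>+x. \<integral>\<^sup>+y. itinerary_mismatch h0 n (T s x) (T s y) \<partial>W \<partial>W \<partial>window 0 H)
            + 2 * emeasure W (space M) * (\<integral>\<^sup>+x. sampling_error h0 R x \<partial>slab 0 H)"
        using R by (intro nn_integral_level_spread_le_itinerary h0 nR) auto
      also have "\<dots> \<le> ennreal R * ennreal E + 2 * ennreal w * (ennreal R * ennreal \<xi>)"
        unfolding emW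
      proof (intro add_mono mult_left_mono)
        show "(\<integral>\<^sup>+s. \<integral>\<^sup>+x. \<integral>\<^sup>+y. itinerary_mismatch h0 n (T s x) (T s y) \<partial>W \<partial>W \<partial>window 0 H) \<le> ennreal E"
          using mismatch by (simp add: itinerary_mismatch_def E_def w_def)
        have "(\<integral>\<^sup>+x. sampling_error h0 R x \<partial>slab 0 H) \<le> (\<integral>\<^sup>+x. sampling_error h0 R x \<partial>M)"
          by (intro nn_integral_mono_measure) (auto simp: le_measure slab_le)
        also have "\<dots> \<le> ennreal R * ennreal \<xi>"
          using R by (intro nn_integral_sampling_error h0 cont) auto
        finally show "(\<integral>\<^sup>+x. sampling_error h0 R x \<partial>slab 0 H) \<le> ennreal R * ennreal \<xi>" .
      qed auto
      also have "\<dots> = ennreal (R * E + 2 * w * (R * \<xi>))"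
        using R E0 w \<xi>0 by (simp flip: ennreal_mult ennreal_plus ennreal_numeral)
      also have "\<dots> \<le> ennreal (w * ((3 * \<delta> / \<kappa> + 2 * \<xi>) * R))"
      proof (intro ennreal_leI)
        have "3 * \<delta> \<le> 3 * \<delta> / \<kappa>" using \<delta>(1) \<kappa> by (simp add: field_simps)
        then have "E \<le> w * (3 * \<delta> / \<kappa>)" using EwH mult_left_mono[of "3 * \<delta>" "3 * \<delta> / \<kappa>" w] w by linarith
        then have "R * E \<le> R * (w * (3 * \<delta> / \<kappa>))" using R by (intro mult_left_mono) auto
        then show "R * E + 2 * w * (R * \<xi>) \<le> w * ((3 * \<delta> / \<kappa> + 2 * \<xi>) * R)" by (simp add: algebra_simps)
      qed
      finally show ?thesis
        using True H \<kappa>(1) by (intro finish[of R H]) (auto simp: field_simps)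
    next
      case False
      define r where "r = \<kappa> * H"
      define H' where "H' = H - r"
      have H': "0 < H'" "H' \<le> H" using H \<kappa> by (auto simp: H'_def r_def)
      have r0: "0 < r" using H \<kappa> by (simp add: r_def)
      have "(\<integral>\<^sup>+s. level_spread r s \<partial>window 0 H') \<le> (\<integral>\<^sup>+s. ennreal E \<partial>window 0 H')"
      proof (rule nn_integral_mono_AE, rule AE_mp[OF AE_window], intro AE_I2 impI)
        fix s assume s: "0 \<le> s \<and> s < H'"
        then have "level_spread r s
            \<le> (\<integral>\<^sup>+t. \<integral>\<^sup>+x. \<integral>\<^sup>+y. of_bool (itinerary h0 n (T t x) \<noteq> itinerary h0 n (T t y)) \<partial>W \<partial>W \<partial>window 0 H)"
          by (intro level_spread_le_tower itinerary_refines_colour[OF _ n(1)]) (auto simp: H'_def)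
        then show "level_spread r s \<le> ennreal E"
          using mismatch by (simp add: E_def w_def)
      qed
      also have "\<dots> = ennreal (E * H')" using H' E0 by (simp add: ennreal_mult)
      also have "\<dots> \<le> ennreal (w * ((3 * \<delta> / \<kappa> + 2 * \<xi>) * r))"
      proof (intro ennreal_leI)
        have "E * H' \<le> (w * (3 * \<delta>)) * H" using EwH E0 H' w \<delta>(1) H by (intro mult_mono) auto
        also have "\<dots> = w * (3 * \<delta> / \<kappa> * r)" using \<kappa> by (simp add: r_def)
        also have "\<dots> \<le> w * ((3 * \<delta> / \<kappa> + 2 * \<xi>) * r)"
          using w r0 \<xi>0 by (intro mult_left_mono mult_right_mono) auto
        finally show "E * H' \<le> w * ((3 * \<delta> / \<kappa> + 2 * \<xi>) * r)" .
      qed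
      finally show ?thesis
      proof (rule finish[rotated -1])
        show "R \<le> r" using False by (simp add: r_def)
        show "H' \<le> r / \<kappa>" using H' \<kappa> by (simp add: r_def)
        have "r * w \<le> \<kappa> * 1" using mult_left_mono[OF wH1, of \<kappa>] \<kappa> by (simp add: r_def mult_ac)
        then show "H * w - \<kappa> \<le> H' * w" by (simp add: H'_def algebra_simps)
      qed (use H' in auto)
    qed
  qed
  moreover have "0 < K" using \<kappa> h0 by (simp add: K_def add_pos_pos)
  ultimately show ?thesis by blast
qed

text \<open>
  For \<open>r \<ge> 1\<close> the integer part of \<open>r\<close> is at least \<open>r / 2\<close>, so for arbitrarily large \<open>r\<close> the quotient is
  at most \<open>2K / g(n)\<^sup>t\<close> with \<open>n\<close> the integer part of \<open>r\<close>.
\<close>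
lemma growth_rate_eq_0:
  fixes M :: "'a measure"
  assumes g: "\<And>n. 0 < g n" and glim: "filterlim g at_top sequentially"
    and cov: "\<exists>K>0. \<forall>R\<ge>1. \<exists>r\<ge>R. \<exists>m. covering_number M T k P r \<epsilon> \<beta> \<le> enat m \<and> real m \<le> K * r"
  shows "growth_rate M T (\<lambda>n t. real n * g n powr t) k P \<epsilon> \<beta> = 0"
proof -
  obtain K where K: "K > 0"
    "\<And>R. R \<ge> 1 \<Longrightarrow> \<exists>r\<ge>R. \<exists>m. covering_number M T k P r \<epsilon> \<beta> \<le> enat m \<and> real m \<le> K * r"
    using cov by blast
  have "\<not> 0 < Liminf at_top (\<lambda>r::real. ennreal_of_enat (covering_number M T k P r \<epsilon> \<beta>)
      / ennreal (real (nat \<lfloor>r\<rfloor>) * g (nat \<lfloor>r\<rfloor>) powr t))" if t: "0 < t" for t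
  proof
    assume "0 < Liminf at_top (\<lambda>r::real. ennreal_of_enat (covering_number M T k P r \<epsilon> \<beta>)
      / ennreal (real (nat \<lfloor>r\<rfloor>) * g (nat \<lfloor>r\<rfloor>) powr t))"
    then obtain y0 where y0: "0 < y0" "y0 < Liminf at_top (\<lambda>r::real. ennreal_of_enat (covering_number M T k P r \<epsilon> \<beta>)
      / ennreal (real (nat \<lfloor>r\<rfloor>) * g (nat \<lfloor>r\<rfloor>) powr t))" using dense by blast
    have "y0 \<noteq> top" using y0(2) by (auto simp: top_unique)
    then obtain y where y: "y0 = ennreal y" "0 < y" using y0(1) by (cases y0) auto
    have low: "\<forall>\<^sub>F r::real in at_top. ennreal y < ennreal_of_enat (covering_number M T k P r \<epsilon> \<beta>)
      / ennreal (real (nat \<lfloor>r\<rfloor>) * g (nat \<lfloor>r\<rfloor>) powr t)"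
      using y0(2) unfolding y(1) by (rule less_LiminfD)
    have "\<forall>\<^sub>F n in sequentially. (2 * K / y) powr (1 / t) < g n"
      using glim by (simp add: filterlim_at_top_dense)
    then obtain n0 where n0: "\<And>n. n \<ge> n0 \<Longrightarrow> (2 * K / y) powr (1 / t) < g n"
      by (auto simp: eventually_sequentially)
    from low obtain r0 where r0: "\<And>r. r \<ge> r0 \<Longrightarrow> ennreal y < ennreal_of_enat (covering_number M T k P r \<epsilon> \<beta>)
      / ennreal (real (nat \<lfloor>r\<rfloor>) * g (nat \<lfloor>r\<rfloor>) powr t)"
      by (auto simp: eventually_at_top_linorder)
    have "\<exists>r\<ge>max (max 1 r0) (real n0). \<exists>m. covering_number M T k P r \<epsilon> \<beta> \<le> enat m \<and> real m \<le> K * r"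
      by (rule K(2)) simp
    then obtain r m where r: "max (max 1 r0) (real n0) \<le> r"
      and m: "covering_number M T k P r \<epsilon> \<beta> \<le> enat m" "real m \<le> K * r"
      by blast
    define q where "q = nat \<lfloor>r\<rfloor>"
    have "1 \<le> \<lfloor>r\<rfloor>" using r by (simp add: le_floor_iff)
    then have "1 \<le> q" "r < real q + 1" unfolding q_def by (simp_all add: nat_le_eq_zle le_nat_iff)
    moreover have "n0 \<le> q" using r unfolding q_def by (simp add: le_nat_floor)
    ultimately have q: "n0 \<le> q" "1 \<le> q" "r \<le> 2 * real q" by linarith+
    have "2 * K / y = ((2 * K / y) powr (1 / t)) powr t"
      using K(1) y(2) t by (simp add: powr_powr)
    also have "\<dots> < g q powr t"
      using n0[OF q(1)] t by (intro powr_less_mono2) auto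
    finally have gq: "2 * K < y * g q powr t" using y(2) by (simp add: field_simps)
    have "K * r \<le> 2 * K * real q" using q(3) K(1) by simp
    also have "\<dots> \<le> y * g q powr t * real q" using gq by (intro mult_right_mono) auto
    finally have "real m \<le> y * (real q * g q powr t)" using m(2) by (simp add: mult_ac)
    moreover have pos: "0 < real q * g q powr t" using q(2) g[of q] by (simp add: zero_less_mult_iff)
    ultimately have "real m / (real q * g q powr t) \<le> y" by (simp add: pos_divide_le_eq)
    have "ennreal_of_enat (covering_number M T k P r \<epsilon> \<beta>) \<le> ennreal (real m)"
      using m(1) by (metis ennreal_of_enat_enat ennreal_of_enat_le_iff ennreal_of_nat_eq_real_of_nat)
    then have "ennreal_of_enat (covering_number M T k P r \<epsilon> \<beta>) / ennreal (real q * g q powr t)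
        \<le> ennreal (real m) / ennreal (real q * g q powr t)"
      by (rule divide_right_mono_ennreal)
    also have "\<dots> = ennreal (real m / (real q * g q powr t))" using pos by (simp add: divide_ennreal)
    also have "\<dots> \<le> ennreal y" by (rule ennreal_leI) fact
    finally show False using r0[of r] r unfolding q_def by (simp add: not_le[symmetric])
  qed
  then have "{t. 0 < t \<and> 0 < Liminf at_top (\<lambda>r::real. ennreal_of_enat (covering_number M T k P r \<epsilon> \<beta>)
      / ennreal (real (nat \<lfloor>r\<rfloor>) * g (nat \<lfloor>r\<rfloor>) powr t))} = {}" by blast
  then show ?thesis unfolding growth_rate_def by (simp only: image_empty Sup_empty bot_ennreal)
qed

section \<open>Slow entropy\<close>

theorem proposition1p3:
  fixes M :: "'a measure" and T :: "real \<Rightarrow> 'a \<Rightarrow> 'a" and g :: "nat \<Rightarrow> real" and \<beta> :: real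
  assumes "\<And>n. 0 < g n"
    and "filterlim g at_top sequentially"
    and "0 < \<beta>" and "\<beta> \<le> 1"
    and "beta_rank_one_flow M T \<beta>"
  shows "slow_entropy M T (\<lambda>n t. real n * g n powr t) \<beta> = 0"
proof -
  interpret ergodic_flow M T using assms(5) by (simp add: beta_rank_one_flow_def)
  let ?a = "\<lambda>n t. real n * g n powr t"
  have "partition_slow_entropy M T ?a \<beta> k P = 0" if P: "finite_measurable_partition M k P" for k P
  proof -
    interpret coloured_flow M T "atom_index k P" by (rule coloured_flow_atom_index[OF P])
    have "growth_rate M T ?a k P \<epsilon> \<beta> = 0" if \<epsilon>: "0 < \<epsilon>" "\<epsilon> < 1" for \<epsilon>
    proof (rule growth_rate_eq_0[OF assms(1,2)])
      obtain K where K: "K > 0" "\<And>R. R \<ge> 1 \<Longrightarrow> \<exists>r\<ge>R. \<exists>C. C \<subseteq> space M \<and> finite C \<and> real (card C) \<le> K * r \<and>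
          \<beta> - \<epsilon> < measure M {y \<in> space M. \<exists>x\<in>C. name_dist r x y < ennreal (\<epsilon> * r)}"
        using names_covering[OF assms(5,3) \<epsilon>] by blast
      have "\<exists>r\<ge>R. \<exists>m. covering_number M T k P r \<epsilon> \<beta> \<le> enat m \<and> real m \<le> K * r" if "R \<ge> 1" for R
      proof -
        obtain r C where r: "r \<ge> R" and C: "C \<subseteq> space M" "finite C" "real (card C) \<le> K * r"
          "\<beta> - \<epsilon> < measure M {y \<in> space M. \<exists>x\<in>C. name_dist r x y < ennreal (\<epsilon> * r)}"
          using K(2)[OF \<open>R \<ge> 1\<close>] by blast
        have "covering_number M T k P r \<epsilon> \<beta> \<le> enat (card C)"
          using covering_number_le[OF P _ \<epsilon>(1) C(1,2,4)] r that by simp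
        then show ?thesis using r C(3) by blast
      qed
      then show "\<exists>K>0. \<forall>R\<ge>1. \<exists>r\<ge>R. \<exists>m. covering_number M T k P r \<epsilon> \<beta> \<le> enat m \<and> real m \<le> K * r"
        using K(1) by blast
    qed
    then have "\<forall>\<^sub>F \<epsilon> in at_right 0. growth_rate M T ?a k P \<epsilon> \<beta> = 0"
      unfolding eventually_at_right_field by (intro exI[of _ 1]) auto
    then have "((\<lambda>\<epsilon>. growth_rate M T ?a k P \<epsilon> \<beta>) \<longlongrightarrow> 0) (at_right 0)"
      by (rule tendsto_eventually)
    then show ?thesis unfolding partition_slow_entropy_def
      by (intro tendsto_Lim) (simp_all add: trivial_limit_at_right_real)
  qed
  then show ?thesis unfolding slow_entropy_def by (auto simp: bot_ennreal intro!: SUP_eqI)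
qed

end
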